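(* Let $\gamma$ be a smooth curve with nowhere vanishing velocity in the conformal sphere $S^n$, given in the flat coordinates by $X(t)=(X^i(t))\in\mathbb R^n$, with $\Delta_4$ a non-zero constant and $\Delta_5=0$ along $\gamma$. For pairwise distinct $a,b,c,d\in\{0,\dots,N\}$ let $P^{abcd}(t)$ be the pairing, with respect to the tractor metric, of $T_4=\mathbb T\wedge\mathbb U\wedge\mathbb A\wedge\mathbb A'$ at time $t$ with the value at $X(t)$ of the parallel $4$-tractor $s_{abcd}$ determined by $e_{abcd}$. Then for indices $i,j,k,l\in\{1,\dots,n\}$, the quantities $Q^{0ijN}=P^{0ijN}$, $Q^{0ijk}=P^{0ijk}$, $Q^{ijkN}=-P^{ijkN}$, $Q^{ijkl}=P^{ijkl}$ are constant along $\gamma$ and are given by $$Q^{0ijN}=3u^{-4}\langle U,A\rangle\,\epsilon^{ij}(U,A)-u^{-2}\epsilon^{ij}(U,A')+u^{-4}\epsilon^{ijl}(U,A,A')X_l,$$ $$Q^{0ijk}=3u^{-4}\langle U,A\rangle\,\epsilon^{ijk}(X,U,A)-u^{-2}\epsilon^{ijk}(X,U,A')+\tfrac12|X|^2u^{-4}\epsilon^{ijk}(U,A,A')+u^{-4}\epsilon^{ijkl}(X,U,A,A')X_l,$$ $$Q^{ijkN}=u^{-4}\epsilon^{ijk}(U,A,A'),$$ $$Q^{ijkl}=u^{-4}\epsilon^{ijkl}(X,U,A,A').$$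
   Context: The conformal sphere $S^n$ (the sphere with the conformal class of the round metric) is described in local flat coordinates $X\in\mathbb R^n$, with $\langle\cdot,\cdot\rangle$ the standard scalar product and $|X|^2=\langle X,X\rangle$. For a curve $X(t)$ put $U=X'$, $A=X''$, $A'=X'''$ ($'=d/dt$), and $u=\sqrt{\langle U,U\rangle}$. Indices $i,j,k,l$ run over $1,\dots,n$, repeated indices are summed, and indices are lowered with the Euclidean metric. The tensor $\epsilon^{i_1\dots i_m}$ acts by $\epsilon^{i_1\dots i_m}(Y_1,\dots,Y_m)=\det\big((Y_b)^{i_a}\big)_{a,b=1}^m$. Tractors: let $N=n+1$ and let $e_0,e_1,\dots,e_n,e_N$ be the standard basis of $\mathbb R^{n+2}$. The tractor metric $h$ is the bilinear form with $h(e_0,e_N)=1$, $h(e_i,e_j)=\delta_{ij}$ for $1\le i,j\le n$, and all other products of basis vectors zero; on $\wedge^4\mathbb R^{n+2}$ the pairing is the induced one, $h(a_1\wedge\dots\wedge a_4,b_1\wedge\dots\wedge b_4)=\det(h(a_p,b_q))$. For $Y\in\mathbb R^n$ let $\rho(Y)$ be the linear map of $\mathbb R^{n+2}$ with $\rho(Y)e_0=\sum_iY^ie_i$, $\rho(Y)e_i=-Y^ie_N$, $\rho(Y)e_N=0$, and let $\rho_4(Y)$ be its extension to $\wedge^4\mathbb R^{n+2}$ as a derivation. Sections of the standard tractor bundle along the curve are identified with $\mathbb R^{n+2}$-valued functions of $t$, and the tractor derivative along the curve is $\nabla\mathbb X=\frac{d}{dt}\mathbb X+\rho(U)\mathbb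 X$ (analogously with $\rho_4$ on $\wedge^4$). For $e_{abcd}=e_a\wedge e_b\wedge e_c\wedge e_d$, the corresponding parallel tractor is the function $s_{abcd}(X)=\exp(-\rho_4(X))e_{abcd}$. The canonical tractors of the curve are $\mathbb T=u^{-1}e_0$, $\mathbb U=\nabla\mathbb T$, $\mathbb A=\nabla\mathbb U$, $\mathbb A'=\nabla\mathbb A$, $\mathbb A''=\nabla\mathbb A'$. $\Delta_4$ and $\Delta_5$ denote the determinants of the Gram matrices with respect to $h$ of $(\mathbb T,\mathbb U,\mathbb A,\mathbb A')$ and $(\mathbb T,\mathbb U,\mathbb A,\mathbb A',\mathbb A'')$ respectively. *)

theory Defs
  imports "HOL-Analysis.Analysis"
begin

text \<open>The index set $\{0, 1, \dots, n, N\}$ of the standard basis of $\mathbb{R}^{n+2}$;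
  the type \<^typ>\<open>'n\<close> plays the role of $\{1,\dots,n\}$.\<close>

datatype 'n tractor_index = Zero | Mid 'n | Last

lemma UNIV_tractor_index: "UNIV = insert Zero (insert Last (range Mid))"
  by (auto intro: tractor_index.exhaust)

instance tractor_index :: (finite) finite
  by standard (simp add: UNIV_tractor_index)

type_synonym 'n tractor = "real ^ 'n tractor_index"

definition basis_tractor :: "'n::finite tractor_index \<Rightarrow> 'n tractor" where
  "basis_tractor a = axis a 1"

fun metric_coeff :: "'n tractor_index \<Rightarrow> 'n tractor_index \<Rightarrow> real" where
  "metric_coeff Zero Last = 1"
| "metric_coeff Last Zero = 1"
| "metric_coeff (Mid i) (Mid j) = (if i = j then 1 else 0)"
| "metric_coeff _ _ = 0"

definition tractor_metric :: "'n::finite tractor \<Rightarrow> 'n tractor \<Rightarrow> real" where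
  "tractor_metric v w = (\<Sum>a\<in>UNIV. \<Sum>b\<in>UNIV. v $ a * w $ b * metric_coeff a b)"

primrec rho_basis :: "real ^ 'n::finite \<Rightarrow> 'n tractor_index \<Rightarrow> 'n tractor" where
  "rho_basis Y Zero = (\<Sum>i\<in>UNIV. Y $ i *\<^sub>R basis_tractor (Mid i))"
| "rho_basis Y (Mid i) = - (Y $ i *\<^sub>R basis_tractor Last)"
| "rho_basis Y Last = 0"

definition rho :: "real ^ 'n::finite \<Rightarrow> 'n tractor \<Rightarrow> 'n tractor" where
  "rho Y v = (\<Sum>a\<in>UNIV. v $ a *\<^sub>R rho_basis Y a)"

text \<open>The exterior power of degree \<open>CARD('k)\<close> is realised inside the tensors with \<open>CARD('k)\<close>
  tractor indices, with
  $a_1\wedge\dots\wedge a_k = \sum_\sigma \mathrm{sgn}(\sigma)\, a_{\sigma(1)}\otimes\dots\otimes a_{\sigma(k)}$.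
  The derivation and the pairing are defined on all tensors; the factor $1/k!$ in the pairing
  is the one for which it restricts to the Gram determinant on decomposable elements
  (lemma \<open>tensor_metric_wedge\<close>).\<close>

type_synonym ('n, 'k) tractor_tensor = "real ^ ('n tractor_index ^ 'k)"

definition wedge :: "'n::finite tractor ^ 'k \<Rightarrow> ('n, 'k::finite) tractor_tensor" where
  "wedge V = (\<chi> I. det (\<chi> p q. V $ p $ (I $ q)))"

definition tensor_metric ::
    "('n::finite, 'k::finite) tractor_tensor \<Rightarrow> ('n, 'k) tractor_tensor \<Rightarrow> real" where
  "tensor_metric S S' =
     (\<Sum>I\<in>UNIV. \<Sum>J\<in>UNIV. S $ I * S' $ J * (\<Prod>q\<in>UNIV. metric_coeff (I $ q) (J $ q)))
       / fact CARD('k)"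

definition rho_tensor ::
    "real ^ 'n::finite \<Rightarrow> ('n, 'k::finite) tractor_tensor \<Rightarrow> ('n, 'k) tractor_tensor" where
  "rho_tensor Y S =
     (\<chi> I. \<Sum>q\<in>UNIV. \<Sum>m\<in>UNIV. rho_basis Y m $ (I $ q) * S $ (\<chi> r. if r = q then m else I $ r))"

lemma sum_UNIV_vec_eq_sum_UNIV_fun:
  fixes F :: "('a::finite ^ 'k::finite) \<Rightarrow> real"
  shows "(\<Sum>I\<in>UNIV. F I) = (\<Sum>f\<in>UNIV. F (\<chi> q. f q))"
  by (rule sum.reindex_bij_witness[where i = "\<lambda>f. \<chi> q. f q" and j = "\<lambda>I q. I $ q"]) auto

lemma sum_prod_vec:
  fixes g :: "'k::finite \<Rightarrow> 'a::finite \<Rightarrow> real"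
  shows "(\<Sum>I\<in>UNIV. \<Prod>q\<in>UNIV. g q (I $ q)) = (\<Prod>q\<in>UNIV. \<Sum>m\<in>UNIV. g q m)"
  unfolding sum_UNIV_vec_eq_sum_UNIV_fun
  using prod_sum_PiE[of "UNIV :: 'k set" "\<lambda>_. UNIV :: 'a set" g] by (simp add: PiE_UNIV_domain)

lemma tensor_metric_wedge:
  fixes V W :: "'n::finite tractor ^ 'k::finite"
  shows "tensor_metric (wedge V) (wedge W) = det (\<chi> p q. tractor_metric (V $ p) (W $ q))"
proof -
  define S where "S = {s. s permutes (UNIV :: 'k set)}"
  define sg where "sg s = (of_int (sign s) :: real)" for s :: "'k \<Rightarrow> 'k"
  define M where "M = (\<chi> p q. tractor_metric (V $ p) (W $ q))"
  have fin: "finite S" by (simp add: S_def)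
  have w: "wedge V $ I = (\<Sum>s\<in>S. sg s * (\<Prod>p\<in>UNIV. V $ p $ (I $ s p)))" for V :: "'n tractor ^ 'k" and I
    by (simp add: wedge_def det_def S_def sg_def)
  have per: "(\<Prod>p\<in>UNIV. X p (s p)) = (\<Prod>q\<in>UNIV. X (inv s q) q)" if "s \<in> S"
    for s and X :: "'k \<Rightarrow> 'k \<Rightarrow> real"
  proof -
    have "s permutes UNIV" using that by (simp add: S_def)
    thus ?thesis
      using prod.permute[of s UNIV "\<lambda>q. X (inv s q) q"]
      by (simp add: permutes_inverses o_def)
  qed
  have pair: "(\<Sum>I\<in>UNIV. \<Sum>J\<in>UNIV. (\<Prod>p\<in>UNIV. V $ p $ (I $ s p)) * (\<Prod>p\<in>UNIV. W $ p $ (J $ t p))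
        * (\<Prod>q\<in>UNIV. metric_coeff (I $ q) (J $ q)))
      = (\<Prod>q\<in>UNIV. M $ (inv s q) $ (inv t q))" if s: "s \<in> S" and t: "t \<in> S" for s t
  proof -
    have "(\<Sum>I\<in>UNIV. \<Sum>J\<in>UNIV. (\<Prod>p\<in>UNIV. V $ p $ (I $ s p)) * (\<Prod>p\<in>UNIV. W $ p $ (J $ t p))
        * (\<Prod>q\<in>UNIV. metric_coeff (I $ q) (J $ q)))
      = (\<Sum>I\<in>UNIV. \<Sum>J\<in>UNIV. \<Prod>q\<in>UNIV. V $ (inv s q) $ (I $ q) * W $ (inv t q) $ (J $ q)
        * metric_coeff (I $ q) (J $ q))"
      by (simp add: prod.distrib per[OF s, where X = "\<lambda>p q. V $ p $ (_ $ q)"]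
          per[OF t, where X = "\<lambda>p q. W $ p $ (_ $ q)"])
    also have "\<dots> = (\<Sum>I\<in>UNIV. \<Prod>q\<in>UNIV. \<Sum>b\<in>UNIV. V $ (inv s q) $ (I $ q) * W $ (inv t q) $ b
        * metric_coeff (I $ q) b)"
      by (intro sum.cong refl sum_prod_vec)
    also have "\<dots> = (\<Prod>q\<in>UNIV. \<Sum>a\<in>UNIV. \<Sum>b\<in>UNIV. V $ (inv s q) $ a * W $ (inv t q) $ b
        * metric_coeff a b)"
      by (rule sum_prod_vec)
    finally show ?thesis by (simp add: M_def tractor_metric_def)
  qed
  have detM: "(\<Sum>t\<in>S. sg s * sg t * (\<Prod>q\<in>UNIV. M $ (inv s q) $ (inv t q))) = det M" if s: "s \<in> S" for s
  proof -
    have sp: "s permutes UNIV" using s by (simp add: S_def)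
    have "(\<Sum>t\<in>S. sg s * sg t * (\<Prod>q\<in>UNIV. M $ (inv s q) $ (inv t q)))
      = (\<Sum>r\<in>S. sg r * (\<Prod>p\<in>UNIV. M $ p $ r p))"
    proof (rule sum.reindex_bij_witness[where i = "\<lambda>r. s \<circ> inv r" and j = "\<lambda>t. inv t \<circ> s"])
      fix t assume "t \<in> S"
      hence tp: "t permutes UNIV" by (simp add: S_def)
      have it: "inv t permutes UNIV" using tp by (rule permutes_inv)
      have c: "inv t \<circ> s permutes UNIV" using sp it by (rule permutes_compose)
      show "inv t \<circ> s \<in> S" using c by (simp add: S_def)
      have "inv (inv t \<circ> s) = inv s \<circ> t"
        using sp tp it by (simp add: o_inv_distrib permutes_bij permutes_inv_inv)
      thus "s \<circ> inv (inv t \<circ> s) = t"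
        using sp by (simp add: fun_eq_iff permutes_inverses)
      have "sg (inv t \<circ> s) = sg s * sg t"
        using sign_compose[OF permutes_imp_permutation[OF _ it] permutes_imp_permutation[OF _ sp]]
          sign_inverse[OF permutes_imp_permutation[OF _ tp]]
        by (simp add: sg_def)
      moreover have "(\<Prod>q\<in>UNIV. M $ (inv s q) $ (inv t q)) = (\<Prod>p\<in>UNIV. M $ p $ (inv t \<circ> s) p)"
        using prod.permute[OF sp, of "\<lambda>q. M $ (inv s q) $ (inv t q)"] sp
        by (simp add: o_def permutes_inverses)
      ultimately show "sg (inv t \<circ> s) * (\<Prod>p\<in>UNIV. M $ p $ (inv t \<circ> s) p)
        = sg s * sg t * (\<Prod>q\<in>UNIV. M $ (inv s q) $ (inv t q))" by simp
    next
      fix r assume "r \<in> S"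
      hence rp: "r permutes UNIV" by (simp add: S_def)
      have ir: "inv r permutes UNIV" using rp by (rule permutes_inv)
      show "s \<circ> inv r \<in> S" using permutes_compose[OF ir sp] by (simp add: S_def)
      have "inv (s \<circ> inv r) = r \<circ> inv s"
        using sp rp ir by (simp add: o_inv_distrib permutes_bij permutes_inv_inv)
      thus "inv (s \<circ> inv r) \<circ> s = r" using sp by (simp add: fun_eq_iff permutes_inverses)
    qed
    thus ?thesis by (simp add: det_def S_def sg_def)
  qed
  have "(\<Sum>I\<in>UNIV. \<Sum>J\<in>UNIV. wedge V $ I * wedge W $ J * (\<Prod>q\<in>UNIV. metric_coeff (I $ q) (J $ q)))
    = (\<Sum>I\<in>UNIV. \<Sum>J\<in>UNIV. \<Sum>s\<in>S. \<Sum>t\<in>S. sg s * sg t * ((\<Prod>p\<in>UNIV. V $ p $ (I $ s p))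
        * (\<Prod>p\<in>UNIV. W $ p $ (J $ t p)) * (\<Prod>q\<in>UNIV. metric_coeff (I $ q) (J $ q))))"
    unfolding w sum_product sum_distrib_right by (intro sum.cong refl) (simp add: sum_distrib_left mult_ac)
  also have "\<dots> = (\<Sum>s\<in>S. \<Sum>t\<in>S. \<Sum>I\<in>UNIV. \<Sum>J\<in>UNIV. sg s * sg t * ((\<Prod>p\<in>UNIV. V $ p $ (I $ s p))
        * (\<Prod>p\<in>UNIV. W $ p $ (J $ t p)) * (\<Prod>q\<in>UNIV. metric_coeff (I $ q) (J $ q))))"
    by (simp only: sum.swap[of _ S "UNIV :: ('n tractor_index ^ 'k) set"])
  also have "\<dots> = (\<Sum>s\<in>S. \<Sum>t\<in>S. sg s * sg t * (\<Prod>q\<in>UNIV. M $ (inv s q) $ (inv t q)))"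
    by (intro sum.cong refl) (simp only: sum_distrib_left[symmetric] pair)
  also have "\<dots> = (\<Sum>s\<in>S. det M)" by (intro sum.cong refl detM)
  also have "\<dots> = fact CARD('k) * det M"
    by (simp add: S_def card_permutations)
  finally show ?thesis by (simp add: tensor_metric_def M_def)
qed

lemma rho_component: "rho Y v $ a = (\<Sum>m\<in>UNIV. rho_basis Y m $ a * v $ m)"
  by (simp add: rho_def mult.commute)

lemma rho_tensor_wedge:
  fixes V :: "'n::finite tractor ^ 'k::finite"
  shows "rho_tensor Y (wedge V) = (\<Sum>p\<in>UNIV. wedge (\<chi> r. if r = p then rho Y (V $ r) else V $ r))"
proof -
  define S where "S = {s. s permutes (UNIV :: 'k set)}"
  define sg where "sg s = (of_int (sign s) :: real)" for s :: "'k \<Rightarrow> 'k"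
  have w: "wedge V $ I = (\<Sum>s\<in>S. sg s * (\<Prod>p\<in>UNIV. V $ p $ (I $ s p)))" for V :: "'n tractor ^ 'k" and I
    by (simp add: wedge_def det_def S_def sg_def)
  have split: "(\<Prod>p\<in>UNIV. f p) = f p0 * (\<Prod>p\<in>UNIV - {p0}. f p)" for f :: "'k \<Rightarrow> real" and p0
    by (rule prod.remove) auto
  have "rho_tensor Y (wedge V) $ I
      = (\<Sum>p\<in>UNIV. wedge (\<chi> r. if r = p then rho Y (V $ r) else V $ r) $ I)" for I
  proof -
    have "rho_tensor Y (wedge V) $ I = (\<Sum>q\<in>UNIV. \<Sum>m\<in>UNIV. \<Sum>s\<in>S. rho_basis Y m $ (I $ q) *
        (sg s * (\<Prod>p\<in>UNIV. V $ p $ (if s p = q then m else I $ s p))))"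
      by (simp add: rho_tensor_def w sum_distrib_left)
    also have "\<dots> = (\<Sum>s\<in>S. \<Sum>q\<in>UNIV. \<Sum>m\<in>UNIV. rho_basis Y m $ (I $ q) *
        (sg s * (\<Prod>p\<in>UNIV. V $ p $ (if s p = q then m else I $ s p))))"
      by (simp only: sum.swap[of _ S])
    also have "\<dots> = (\<Sum>s\<in>S. \<Sum>p0\<in>UNIV.
        sg s * (rho Y (V $ p0) $ (I $ s p0) * (\<Prod>p\<in>UNIV - {p0}. V $ p $ (I $ s p))))"
    proof (rule sum.cong[OF refl])
      fix s assume "s \<in> S"
      hence sp: "s permutes UNIV" by (simp add: S_def)
      have inj: "s p = s p0 \<longleftrightarrow> p = p0" for p p0 using permutes_inj[OF sp] by (auto dest: injD)
      have "(\<Sum>q\<in>UNIV. \<Sum>m\<in>UNIV. rho_basis Y m $ (I $ q) *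
          (sg s * (\<Prod>p\<in>UNIV. V $ p $ (if s p = q then m else I $ s p))))
        = (\<Sum>p0\<in>UNIV. \<Sum>m\<in>UNIV. rho_basis Y m $ (I $ s p0) *
          (sg s * (\<Prod>p\<in>UNIV. V $ p $ (if s p = s p0 then m else I $ s p))))"
        using sum.permute[OF sp, of "\<lambda>q. \<Sum>m\<in>UNIV. rho_basis Y m $ (I $ q) *
          (sg s * (\<Prod>p\<in>UNIV. V $ p $ (if s p = q then m else I $ s p)))"] by (simp add: o_def)
      also have "\<dots> = (\<Sum>p0\<in>UNIV.
          sg s * (rho Y (V $ p0) $ (I $ s p0) * (\<Prod>p\<in>UNIV - {p0}. V $ p $ (I $ s p))))"
      proof (rule sum.cong[OF refl])
        fix p0 :: 'k
        have "(\<Prod>p\<in>UNIV. V $ p $ (if s p = s p0 then m else I $ s p))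
          = V $ p0 $ m * (\<Prod>p\<in>UNIV - {p0}. V $ p $ (I $ s p))" for m
          unfolding split[of _ p0] inj by (auto intro!: prod.cong)
        thus "(\<Sum>m\<in>UNIV. rho_basis Y m $ (I $ s p0) *
            (sg s * (\<Prod>p\<in>UNIV. V $ p $ (if s p = s p0 then m else I $ s p))))
          = sg s * (rho Y (V $ p0) $ (I $ s p0) * (\<Prod>p\<in>UNIV - {p0}. V $ p $ (I $ s p)))"
          by (simp add: rho_component sum_distrib_left sum_distrib_right mult_ac)
      qed
      finally show "(\<Sum>q\<in>UNIV. \<Sum>m\<in>UNIV. rho_basis Y m $ (I $ q) *
          (sg s * (\<Prod>p\<in>UNIV. V $ p $ (if s p = q then m else I $ s p))))
        = (\<Sum>p0\<in>UNIV.
          sg s * (rho Y (V $ p0) $ (I $ s p0) * (\<Prod>p\<in>UNIV - {p0}. V $ p $ (I $ s p))))" .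
    qed
    also have "\<dots> = (\<Sum>p0\<in>UNIV. \<Sum>s\<in>S.
        sg s * (rho Y (V $ p0) $ (I $ s p0) * (\<Prod>p\<in>UNIV - {p0}. V $ p $ (I $ s p))))"
      by (rule sum.swap)
    also have "\<dots> = (\<Sum>p\<in>UNIV. wedge (\<chi> r. if r = p then rho Y (V $ r) else V $ r) $ I)"
    proof (rule sum.cong[OF refl])
      fix p0 :: 'k
      have "(\<Prod>p\<in>UNIV. (\<chi> r. if r = p0 then rho Y (V $ r) else V $ r) $ p $ (I $ s p))
        = rho Y (V $ p0) $ (I $ s p0) * (\<Prod>p\<in>UNIV - {p0}. V $ p $ (I $ s p))" for s
        unfolding split[of _ p0] by (auto intro!: prod.cong)
      thus "(\<Sum>s\<in>S. sg s * (rho Y (V $ p0) $ (I $ s p0) * (\<Prod>p\<in>UNIV - {p0}. V $ p $ (I $ s p))))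
        = wedge (\<chi> r. if r = p0 then rho Y (V $ r) else V $ r) $ I"
        by (simp only: w)
    qed
    finally show ?thesis .
  qed
  thus ?thesis by (simp add: vec_eq_iff)
qed

text \<open>The exponential series of a linear endomorphism. It is only used for \<open>- rho_tensor X\<close>,
  which is nilpotent, so the series is a finite sum.\<close>

definition exp_endo :: "('a::real_normed_vector \<Rightarrow> 'a) \<Rightarrow> 'a \<Rightarrow> 'a" where
  "exp_endo L v = (\<Sum>k. (L ^^ k) v /\<^sub>R fact k)"

definition parallel_tractor4 ::
    "'n::finite tractor_index \<Rightarrow> 'n tractor_index \<Rightarrow> 'n tractor_index \<Rightarrow> 'n tractor_index
      \<Rightarrow> real ^ 'n \<Rightarrow> ('n, 4) tractor_tensor" where
  "parallel_tractor4 a b c d X =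
     exp_endo (\<lambda>S. - rho_tensor X S)
       (wedge (vector [basis_tractor a, basis_tractor b, basis_tractor c, basis_tractor d]))"

definition deriv_curve :: "(real \<Rightarrow> 'a::real_normed_vector) \<Rightarrow> real \<Rightarrow> 'a" where
  "deriv_curve f t = vector_derivative f (at t)"

definition smooth_curve_on :: "real set \<Rightarrow> (real \<Rightarrow> 'a::real_normed_vector) \<Rightarrow> bool" where
  "smooth_curve_on T f \<longleftrightarrow> (\<forall>k. \<forall>t\<in>T. (deriv_curve ^^ k) f differentiable (at t))"

abbreviation velocity :: "(real \<Rightarrow> real ^ 'n::finite) \<Rightarrow> real \<Rightarrow> real ^ 'n" where
  "velocity X \<equiv> deriv_curve X"

abbreviation acceleration :: "(real \<Rightarrow> real ^ 'n::finite) \<Rightarrow> real \<Rightarrow> real ^ 'n" where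
  "acceleration X \<equiv> deriv_curve (velocity X)"

abbreviation acceleration' :: "(real \<Rightarrow> real ^ 'n::finite) \<Rightarrow> real \<Rightarrow> real ^ 'n" where
  "acceleration' X \<equiv> deriv_curve (acceleration X)"

definition speed :: "(real \<Rightarrow> real ^ 'n::finite) \<Rightarrow> real \<Rightarrow> real" where
  "speed X t = sqrt (velocity X t \<bullet> velocity X t)"

definition tractor_derivative ::
    "(real \<Rightarrow> real ^ 'n::finite) \<Rightarrow> (real \<Rightarrow> 'n tractor) \<Rightarrow> real \<Rightarrow> 'n tractor" where
  "tractor_derivative X V t = deriv_curve V t + rho (velocity X t) (V t)"

definition tractor_T :: "(real \<Rightarrow> real ^ 'n::finite) \<Rightarrow> real \<Rightarrow> 'n tractor" where
  "tractor_T X t = inverse (speed X t) *\<^sub>R basis_tractor Zero"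

definition tractor_U :: "(real \<Rightarrow> real ^ 'n::finite) \<Rightarrow> real \<Rightarrow> 'n tractor" where
  "tractor_U X = tractor_derivative X (tractor_T X)"

definition tractor_A :: "(real \<Rightarrow> real ^ 'n::finite) \<Rightarrow> real \<Rightarrow> 'n tractor" where
  "tractor_A X = tractor_derivative X (tractor_U X)"

definition tractor_A' :: "(real \<Rightarrow> real ^ 'n::finite) \<Rightarrow> real \<Rightarrow> 'n tractor" where
  "tractor_A' X = tractor_derivative X (tractor_A X)"

definition tractor_A'' :: "(real \<Rightarrow> real ^ 'n::finite) \<Rightarrow> real \<Rightarrow> 'n tractor" where
  "tractor_A'' X = tractor_derivative X (tractor_A' X)"

definition gram_det :: "'n::finite tractor ^ 'k::finite \<Rightarrow> real" where
  "gram_det V = det (\<chi> p q. tractor_metric (V $ p) (V $ q))"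

definition Delta4 :: "(real \<Rightarrow> real ^ 'n::finite) \<Rightarrow> real \<Rightarrow> real" where
  "Delta4 X t =
     gram_det (vector [tractor_T X t, tractor_U X t, tractor_A X t, tractor_A' X t] :: 'n tractor ^ 4)"

definition Delta5 :: "(real \<Rightarrow> real ^ 'n::finite) \<Rightarrow> real \<Rightarrow> real" where
  "Delta5 X t =
     gram_det (vector [tractor_T X t, tractor_U X t, tractor_A X t, tractor_A' X t, tractor_A'' X t]
       :: 'n tractor ^ 5)"

definition T4 :: "(real \<Rightarrow> real ^ 'n::finite) \<Rightarrow> real \<Rightarrow> ('n, 4) tractor_tensor" where
  "T4 X t = wedge (vector [tractor_T X t, tractor_U X t, tractor_A X t, tractor_A' X t])"

definition P4 ::
    "(real \<Rightarrow> real ^ 'n::finite) \<Rightarrow> 'n tractor_index \<Rightarrow> 'n tractor_index \<Rightarrow> 'n tractor_index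
      \<Rightarrow> 'n tractor_index \<Rightarrow> real \<Rightarrow> real" where
  "P4 X a b c d t = tensor_metric (T4 X t) (parallel_tractor4 a b c d (X t))"

definition Q_0ijN :: "(real \<Rightarrow> real ^ 'n::finite) \<Rightarrow> 'n \<Rightarrow> 'n \<Rightarrow> real \<Rightarrow> real" where
  "Q_0ijN X i j t = P4 X Zero (Mid i) (Mid j) Last t"

definition Q_0ijk :: "(real \<Rightarrow> real ^ 'n::finite) \<Rightarrow> 'n \<Rightarrow> 'n \<Rightarrow> 'n \<Rightarrow> real \<Rightarrow> real" where
  "Q_0ijk X i j k t = P4 X Zero (Mid i) (Mid j) (Mid k) t"

definition Q_ijkN :: "(real \<Rightarrow> real ^ 'n::finite) \<Rightarrow> 'n \<Rightarrow> 'n \<Rightarrow> 'n \<Rightarrow> real \<Rightarrow> real" where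
  "Q_ijkN X i j k t = - P4 X (Mid i) (Mid j) (Mid k) Last t"

definition Q_ijkl :: "(real \<Rightarrow> real ^ 'n::finite) \<Rightarrow> 'n \<Rightarrow> 'n \<Rightarrow> 'n \<Rightarrow> 'n \<Rightarrow> real \<Rightarrow> real" where
  "Q_ijkl X i j k l t = P4 X (Mid i) (Mid j) (Mid k) (Mid l) t"

definition eps2 :: "'n \<Rightarrow> 'n \<Rightarrow> real ^ 'n \<Rightarrow> real ^ 'n \<Rightarrow> real" where
  "eps2 i j Y1 Y2 = det (vector [vector [Y1 $ i, Y2 $ i],
                                 vector [Y1 $ j, Y2 $ j]] :: real ^ 2 ^ 2)"

definition eps3 :: "'n \<Rightarrow> 'n \<Rightarrow> 'n \<Rightarrow> real ^ 'n \<Rightarrow> real ^ 'n \<Rightarrow> real ^ 'n \<Rightarrow> real" where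
  "eps3 i j k Y1 Y2 Y3 = det (vector [vector [Y1 $ i, Y2 $ i, Y3 $ i],
                                      vector [Y1 $ j, Y2 $ j, Y3 $ j],
                                      vector [Y1 $ k, Y2 $ k, Y3 $ k]] :: real ^ 3 ^ 3)"

definition eps4 ::
    "'n \<Rightarrow> 'n \<Rightarrow> 'n \<Rightarrow> 'n \<Rightarrow> real ^ 'n \<Rightarrow> real ^ 'n \<Rightarrow> real ^ 'n \<Rightarrow> real ^ 'n \<Rightarrow> real" where
  "eps4 i j k l Y1 Y2 Y3 Y4 = det (vector [vector [Y1 $ i, Y2 $ i, Y3 $ i, Y4 $ i],
                                           vector [Y1 $ j, Y2 $ j, Y3 $ j, Y4 $ j],
                                           vector [Y1 $ k, Y2 $ k, Y3 $ k, Y4 $ k],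
                                           vector [Y1 $ l, Y2 $ l, Y3 $ l, Y4 $ l]] :: real ^ 4 ^ 4)"

end

theory Submission
  imports Defs
begin

text \<open>On the flat model \<open>exp (rho X)\<close> turns the tractor derivative into the ordinary one: if
  \<open>W = exp (rho X) V\<close> then \<open>W' = exp (rho X) (\<nabla> V)\<close>. As \<open>exp (rho X)\<close> is an isometry, every \<open>P4\<close> is the
  pairing of a fixed 4-vector with the wedge of four successive derivatives of the curve
  \<open>exp (rho X) tractor_T\<close>. If \<open>Delta5 = 0 \<noteq> Delta4\<close>, the Lorentzian signature forces the fifth canonical
  tractor into the span of the other four, so this wedge satisfies \<open>\<omega>' = d \<omega>\<close>; then
  \<open>Delta4' = 2 d Delta4\<close> and the constancy of \<open>Delta4\<close> gives \<open>d = 0\<close>. The closed formulas come from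
  expanding the 4 by 4 determinant of the pairings.\<close>

section \<open>Determinants and wedge products\<close>

lemma vector_4 [simp]:
  "(vector [x, y, z, w] :: ('a::zero)^4) $ 1 = x"
  "(vector [x, y, z, w] :: ('a::zero)^4) $ 2 = y"
  "(vector [x, y, z, w] :: ('a::zero)^4) $ 3 = z"
  "(vector [x, y, z, w] :: ('a::zero)^4) $ 4 = w"
  unfolding vector_def by simp_all

lemma vector_5 [simp]:
  "(vector [x, y, z, w, v] :: ('a::zero)^5) $ 1 = x"
  "(vector [x, y, z, w, v] :: ('a::zero)^5) $ 2 = y"
  "(vector [x, y, z, w, v] :: ('a::zero)^5) $ 3 = z"
  "(vector [x, y, z, w, v] :: ('a::zero)^5) $ 4 = w"
  "(vector [x, y, z, w, v] :: ('a::zero)^5) $ 5 = v"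
  unfolding vector_def by simp_all

lemma exhaust_5:
  fixes x :: 5
  shows "x = 1 \<or> x = 2 \<or> x = 3 \<or> x = 4 \<or> x = 5"
proof (induct x)
  case (of_int z)
  then have "z = 0 \<or> z = 1 \<or> z = 2 \<or> z = 3 \<or> z = 4" by fastforce
  then show ?case by auto
qed

lemma UNIV_5: "UNIV = {1, 2, 3, 4, 5::5}"
  using exhaust_5 by auto

lemma sum_5: "sum f (UNIV::5 set) = f 1 + f 2 + f 3 + f 4 + f 5"
  unfolding UNIV_5 by (simp add: ac_simps)

lemma det_4:
  "det (A::'a::comm_ring_1^4^4) =
     A$1$1 * (A$2$2 * (A$3$3 * A$4$4 - A$3$4 * A$4$3) - A$2$3 * (A$3$2 * A$4$4 - A$3$4 * A$4$2)
       + A$2$4 * (A$3$2 * A$4$3 - A$3$3 * A$4$2))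
   - A$1$2 * (A$2$1 * (A$3$3 * A$4$4 - A$3$4 * A$4$3) - A$2$3 * (A$3$1 * A$4$4 - A$3$4 * A$4$1)
       + A$2$4 * (A$3$1 * A$4$3 - A$3$3 * A$4$1))
   + A$1$3 * (A$2$1 * (A$3$2 * A$4$4 - A$3$4 * A$4$2) - A$2$2 * (A$3$1 * A$4$4 - A$3$4 * A$4$1)
       + A$2$4 * (A$3$1 * A$4$2 - A$3$2 * A$4$1))
   - A$1$4 * (A$2$1 * (A$3$2 * A$4$3 - A$3$3 * A$4$2) - A$2$2 * (A$3$1 * A$4$3 - A$3$3 * A$4$1)
       + A$2$3 * (A$3$1 * A$4$2 - A$3$2 * A$4$1))"
proof -
  have f1234: "finite {2::4, 3, 4}" "1 \<notin> {2::4, 3, 4}"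
    by auto
  have f234: "finite {3::4, 4}" "2 \<notin> {3::4, 4}"
    by auto
  have f34: "finite {4::4}" "3 \<notin> {4::4}"
    by auto
  show ?thesis
    unfolding det_def UNIV_4
    unfolding sum_over_permutations_insert[OF f1234]
    unfolding sum_over_permutations_insert[OF f234]
    unfolding sum_over_permutations_insert[OF f34]
    unfolding permutes_sing
    by (simp add: sign_swap_id permutation_swap_id permutation_compose sign_compose sign_id swap_id_eq
        algebra_simps)
qed

text \<open>The product rule in each Leibniz term deletes one factor; putting its derivative back in
  the same place and swapping the sums collects determinants with one row differentiated.\<close>

lemma has_real_derivative_det:
  fixes M :: "real \<Rightarrow> real ^ 'k::finite ^ 'k"
  assumes "\<And>p q. ((\<lambda>s. M s $ p $ q) has_real_derivative M' $ p $ q) (at t)"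
  shows "((\<lambda>s. det (M s)) has_real_derivative
           (\<Sum>p\<in>UNIV. det (\<chi> r. if r = p then M' $ r else M t $ r))) (at t)"
proof -
  have "((\<lambda>s. det (M s)) has_real_derivative
      (\<Sum>\<sigma> | \<sigma> permutes UNIV. of_int (sign \<sigma>) *
        (\<Sum>p\<in>UNIV. M' $ p $ \<sigma> p * (\<Prod>r\<in>UNIV - {p}. M t $ r $ \<sigma> r)))) (at t)"
    unfolding det_def
    by (intro DERIV_sum DERIV_cmult has_field_derivative_prod assms)
  also have "(\<Sum>\<sigma> | \<sigma> permutes UNIV. of_int (sign \<sigma>) *
        (\<Sum>p\<in>UNIV. M' $ p $ \<sigma> p * (\<Prod>r\<in>UNIV - {p}. M t $ r $ \<sigma> r)))
      = (\<Sum>\<sigma> | \<sigma> permutes UNIV. \<Sum>p\<in>UNIV. of_int (sign \<sigma>) *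
        (\<Prod>r\<in>UNIV. (if r = p then M' $ r else M t $ r) $ \<sigma> r))"
    unfolding sum_distrib_left
  proof (intro sum.cong refl)
    fix \<sigma> :: "'k \<Rightarrow> 'k" and p :: 'k
    show "real_of_int (sign \<sigma>) * (M' $ p $ \<sigma> p * (\<Prod>r\<in>UNIV - {p}. M t $ r $ \<sigma> r))
      = real_of_int (sign \<sigma>) * (\<Prod>r\<in>UNIV. (if r = p then M' $ r else M t $ r) $ \<sigma> r)"
      by (subst prod.remove[of UNIV p]) auto
  qed
  also have "\<dots> = (\<Sum>p\<in>UNIV. det (\<chi> r. if r = p then M' $ r else M t $ r))"
    unfolding det_def by (subst sum.swap) simp
  finally show ?thesis .
qed

lemma has_vector_derivative_vec_iff:
  fixes f :: "real \<Rightarrow> real ^ 'k::finite"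
  shows "(f has_vector_derivative f') (at t) \<longleftrightarrow>
    (\<forall>i. ((\<lambda>s. f s $ i) has_real_derivative f' $ i) (at t))"
  unfolding has_vector_derivative_def has_derivative_componentwise_within[of f] Basis_vec_def
  by (auto simp: inner_axis has_field_derivative_def mult_commute_abs)

text \<open>Every component of a wedge is a determinant. The one-slot-replaced form of the sum is
  that of \<open>rho_tensor_wedge\<close>, so the two can be compared in
  \<open>parallel_tractor4_eq\<close>.\<close>

lemma has_vector_derivative_wedge:
  assumes "\<And>p. ((\<lambda>s. V s $ p) has_vector_derivative V' $ p) (at t)"
  shows "((\<lambda>s. wedge (V s)) has_vector_derivative
           (\<Sum>p\<in>UNIV. wedge (\<chi> r. if r = p then V' $ r else V t $ r))) (at t)"
  unfolding has_vector_derivative_vec_iff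
proof
  fix I
  have "((\<lambda>s. det (\<chi> p q. V s $ p $ (I $ q))) has_real_derivative
     (\<Sum>p\<in>UNIV. det (\<chi> r. if r = p then (\<chi> p q. V' $ p $ (I $ q)) $ r
        else (\<chi> p q. V t $ p $ (I $ q)) $ r))) (at t)"
    by (rule has_real_derivative_det) (use assms in \<open>simp add: has_vector_derivative_vec_iff\<close>)
  also have "(\<Sum>p\<in>UNIV. det (\<chi> r. if r = p then (\<chi> p q. V' $ p $ (I $ q)) $ r
        else (\<chi> p q. V t $ p $ (I $ q)) $ r))
    = (\<Sum>p\<in>UNIV. wedge (\<chi> r. if r = p then V' $ r else V t $ r)) $ I"
    unfolding wedge_def sum_component vec_lambda_beta
    by (intro sum.cong refl arg_cong[where f = det]) (auto simp: vec_eq_iff)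
  finally show "((\<lambda>s. wedge (V s) $ I) has_real_derivative
      (\<Sum>p\<in>UNIV. wedge (\<chi> r. if r = p then V' $ r else V t $ r)) $ I) (at t)"
    by (simp add: wedge_def)
qed

text \<open>Taylor's theorem applied to the components of \<open>G\<close>, whose derivative of order \<open>m\<close> is \<open>L\<^sup>m G\<close>.\<close>

lemma exp_endo_eq_flow:
  fixes L :: "real ^ 'm::finite \<Rightarrow> real ^ 'm"
  assumes L: "linear L"
    and G: "\<And>s. (G has_vector_derivative L (G s)) (at s)"
  shows "exp_endo L (G 0) = G 1"
proof -
  obtain K where K: "K > 0" "\<And>v. norm (L v) \<le> norm v * K"
    using bounded_linear.pos_bounded L linear_conv_bounded_linear by blast
  have bl: "bounded_linear (L ^^ k)" for k
  proof (induction k)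
    case 0 then show ?case by (simp add: id_def bounded_linear_ident)
  next
    case (Suc k) then show ?case
      using bounded_linear_compose[of L "L ^^ k"] L by (simp add: o_def linear_conv_bounded_linear)
  qed
  have nrm: "norm ((L ^^ k) v) \<le> K ^ k * norm v" for k v
  proof (induction k)
    case (Suc k)
    have "norm ((L ^^ Suc k) v) \<le> norm ((L ^^ k) v) * K" using K(2) by simp
    also have "\<dots> \<le> (K ^ k * norm v) * K" using Suc K(1) by (intro mult_right_mono) auto
    finally show ?case by (simp add: mult_ac)
  qed simp
  have der: "((\<lambda>s. (L ^^ k) (G s)) has_vector_derivative (L ^^ Suc k) (G s)) (at s)" for k s
    using bounded_linear.has_vector_derivative[OF bl[of k] G[of s]] by (simp add: funpow_swap1)
  \<comment> \<open>The intermediate point in the Taylor remainder varies with the order and the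
    component, so a bound for \<open>G\<close> uniform on the compact interval is needed.\<close>
  have "continuous_on {-1..1} G"
    using G by (meson continuous_at_imp_continuous_on has_vector_derivative_continuous)
  then have "bounded (G ` {-1..1})" by (intro compact_imp_bounded compact_continuous_image) auto
  then obtain B where B: "\<And>s. \<bar>s\<bar> \<le> 1 \<Longrightarrow> norm (G s) \<le> B"
    unfolding bounded_iff by (metis abs_le_iff atLeastAtMost_iff image_eqI minus_le_iff)
  have "(\<lambda>k. (L ^^ k) (G 0) /\<^sub>R fact k) sums G 1"
    unfolding sums_def
  proof (rule vec_tendstoI)
    fix i
    have bnd: "\<bar>(\<Sum>k<n. (L ^^ k) (G 0) /\<^sub>R fact k) $ i - G 1 $ i\<bar> \<le> B * (K ^ n /\<^sub>R fact n)" for n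
    proof -
      have "\<exists>\<xi>. \<bar>\<xi>\<bar> \<le> \<bar>1\<bar> \<and> G 1 $ i = (\<Sum>m<n. ((L ^^ m) (G 0) $ i / fact m) * 1 ^ m)
              + ((L ^^ n) (G \<xi>) $ i / fact n) * 1 ^ n"
        by (rule Maclaurin_all_le[where diff = "\<lambda>m s. (L ^^ m) (G s) $ i"])
           (use der in \<open>auto simp: has_vector_derivative_vec_iff simp del: funpow.simps\<close>)
      then obtain \<xi> where \<xi>: "\<bar>\<xi>\<bar> \<le> 1"
        "G 1 $ i = (\<Sum>m<n. (L ^^ m) (G 0) $ i / fact m) + (L ^^ n) (G \<xi>) $ i / fact n" by auto
      have "\<bar>(L ^^ n) (G \<xi>) $ i\<bar> \<le> norm ((L ^^ n) (G \<xi>))" by (rule component_le_norm_cart)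
      also have "\<dots> \<le> K ^ n * norm (G \<xi>)" by (rule nrm)
      also have "\<dots> \<le> K ^ n * B" using B \<xi>(1) K(1) by (intro mult_left_mono) auto
      finally have "\<bar>(L ^^ n) (G \<xi>) $ i\<bar> / fact n \<le> K ^ n * B / fact n"
        by (rule divide_right_mono) simp
      moreover have "(\<Sum>k<n. (L ^^ k) (G 0) /\<^sub>R fact k) $ i - G 1 $ i = - ((L ^^ n) (G \<xi>) $ i / fact n)"
        using \<xi>(2) by (simp add: divide_inverse mult.commute)
      ultimately show ?thesis
        by (simp add: divide_inverse mult_ac abs_mult)
    qed
    have "(\<lambda>n. K ^ n /\<^sub>R fact n) \<longlonglongrightarrow> 0"
      by (rule summable_LIMSEQ_zero[OF summable_exp_generic])
    then have "(\<lambda>n. B * (K ^ n /\<^sub>R fact n)) \<longlonglongrightarrow> 0" by (rule tendsto_mult_right_zero)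
    then have "(\<lambda>n. (\<Sum>k<n. (L ^^ k) (G 0) /\<^sub>R fact k) $ i - G 1 $ i) \<longlonglongrightarrow> 0"
      by (rule Lim_null_comparison[rotated]) (use bnd in simp)
    then show "(\<lambda>n. (\<Sum>k<n. (L ^^ k) (G 0) /\<^sub>R fact k) $ i) \<longlonglongrightarrow> G 1 $ i"
      by (simp add: LIM_zero_iff)
  qed
  then show ?thesis by (simp add: exp_endo_def sums_iff)
qed

section \<open>The standard tractor space\<close>

lemma sum_tractor_index:
  fixes f :: "'n::finite tractor_index \<Rightarrow> 'b::comm_monoid_add"
  shows "(\<Sum>a\<in>UNIV. f a) = f Zero + f Last + (\<Sum>i\<in>UNIV. f (Mid i))"
  unfolding UNIV_tractor_index
  by (subst sum.insert, simp, force, subst sum.insert, simp, force)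
     (simp add: add.assoc sum.reindex inj_on_def)

text \<open>Splitting off the two null directions turns the metric, \<open>rho\<close> and
  \<open>transport\<close> into closed formulas in scalars and Euclidean inner products.\<close>

definition tractor :: "real \<Rightarrow> real ^ 'n::finite \<Rightarrow> real \<Rightarrow> 'n tractor" where
  "tractor a v b = (\<chi> k. case k of Zero \<Rightarrow> a | Mid i \<Rightarrow> v $ i | Last \<Rightarrow> b)"

lemma tractor_nth [simp]:
  "tractor a v b $ Zero = a" "tractor a v b $ Mid i = v $ i" "tractor a v b $ Last = b"
  by (simp_all add: tractor_def)

lemma tractor_eq_iff: "V = W \<longleftrightarrow> V $ Zero = W $ Zero \<and> (\<forall>i. V $ Mid i = W $ Mid i) \<and> V $ Last = W $ Last"
  for V W :: "'n::finite tractor"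
  by (metis vec_eq_iff tractor_index.exhaust)

lemma tractor_cases:
  obtains a v b where "V = tractor a v b"
proof
  show "V = tractor (V $ Zero) (\<chi> i. V $ Mid i) (V $ Last)" by (simp add: tractor_eq_iff)
qed

lemma tractor_inject [simp]: "tractor a v b = tractor a' v' b' \<longleftrightarrow> a = a' \<and> v = v' \<and> b = b'"
  by (auto simp: tractor_eq_iff vec_eq_iff)

lemma tractor_arith [simp]:
  "tractor a v b + tractor a' v' b' = tractor (a + a') (v + v') (b + b')"
  "tractor a v b - tractor a' v' b' = tractor (a - a') (v - v') (b - b')"
  "- tractor a v b = tractor (- a) (- v) (- b)"
  "c *\<^sub>R tractor a v b = tractor (c * a) (c *\<^sub>R v) (c * b)"
  "tractor 0 0 0 = 0"
  by (auto simp: tractor_eq_iff)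

lemma basis_tractor_eq:
  "basis_tractor Zero = tractor 1 0 0" "basis_tractor (Mid i) = tractor 0 (axis i 1) 0"
  "basis_tractor Last = tractor 0 0 1"
  by (auto simp: basis_tractor_def tractor_eq_iff axis_def)

lemma tractor_metric_tractor [simp]:
  "tractor_metric (tractor a v b) (tractor a' v' b') = a * b' + b * a' + v \<bullet> v'"
proof -
  have "(\<Sum>i\<in>UNIV. \<Sum>j\<in>UNIV. v $ i * v' $ j * (if i = j then 1 else 0)) = v \<bullet> v'"
    by (simp add: inner_vec_def if_distrib cong: if_cong)
  then show ?thesis
    by (simp add: tractor_metric_def sum_tractor_index sum.distrib)
qed

lemma rho_tractor [simp]: "rho Y (tractor a v b) = tractor 0 (a *\<^sub>R Y) (- (Y \<bullet> v))"
proof -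
  have "(\<Sum>i\<in>UNIV. v $ i *\<^sub>R rho_basis Y (Mid i)) = tractor 0 0 (- (Y \<bullet> v))"
    by (auto simp: tractor_eq_iff basis_tractor_eq inner_vec_def sum_negf[symmetric] mult.commute)
  moreover have "(\<Sum>i\<in>UNIV. Y $ i *\<^sub>R basis_tractor (Mid i)) = tractor 0 Y 0"
    by (auto simp: tractor_eq_iff basis_tractor_eq axis_def if_distrib cong: if_cong)
  ultimately show ?thesis
    by (simp add: rho_def sum_tractor_index)
qed

lemma has_vector_derivative_tractor:
  assumes "(a has_real_derivative a') (at t)" "(v has_vector_derivative v') (at t)"
    and "(b has_real_derivative b') (at t)"
  shows "((\<lambda>s. tractor (a s) (v s) (b s)) has_vector_derivative tractor a' v' b') (at t)"
  unfolding has_vector_derivative_vec_iff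
proof
  fix k
  show "((\<lambda>s. tractor (a s) (v s) (b s) $ k) has_real_derivative tractor a' v' b' $ k) (at t)"
    using assms by (cases k) (auto simp: has_vector_derivative_vec_iff)
qed

lemma tractor_metric_linear:
  "tractor_metric (v + w) x = tractor_metric v x + tractor_metric w x"
  "tractor_metric (c *\<^sub>R v) x = c * tractor_metric v x"
  by (cases v rule: tractor_cases, cases w rule: tractor_cases, cases x rule: tractor_cases,
      simp add: algebra_simps inner_add_left)+

lemma tractor_metric_commute: "tractor_metric v w = tractor_metric w v"
  by (cases v rule: tractor_cases, cases w rule: tractor_cases) (simp add: inner_commute)

text \<open>\<open>exp (rho Y)\<close>: the series stops because \<open>rho Y\<close> is nilpotent of order three.\<close>

definition transport :: "real ^ 'n::finite \<Rightarrow> 'n tractor \<Rightarrow> 'n tractor" where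
  "transport Y v = v + rho Y v + (1/2) *\<^sub>R rho Y (rho Y v)"

lemma transport_tractor [simp]:
  "transport Y (tractor a v b) = tractor a (v + a *\<^sub>R Y) (b - Y \<bullet> v - a / 2 * (Y \<bullet> Y))"
  by (simp add: transport_def)

lemma transport_linear:
  "transport Y (v + w) = transport Y v + transport Y w"
  "transport Y (c *\<^sub>R v) = c *\<^sub>R transport Y v"
  by (cases v rule: tractor_cases, cases w rule: tractor_cases,
      simp add: algebra_simps inner_add_right add_divide_distrib)+

text \<open>\<open>rho Y\<close> is skew for the tractor metric, so the adjoint of its exponential
  is the exponential of \<open>rho (- Y)\<close>.\<close>

lemma tractor_metric_transport:
  "tractor_metric (transport Y v) w = tractor_metric v (transport (- Y) w)"
  by (cases v rule: tractor_cases, cases w rule: tractor_cases)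
     (simp add: algebra_simps inner_commute inner_add_left inner_add_right)

lemma tractor_metric_transport_transport [simp]:
  "tractor_metric (transport Y v) (transport Y w) = tractor_metric v w"
  by (cases v rule: tractor_cases, cases w rule: tractor_cases)
     (simp add: algebra_simps inner_commute inner_add_left inner_add_right)

text \<open>\<open>rho X\<close> and \<open>rho X'\<close> commute: their composite in either order
  only sends the \<open>Zero\<close> slot to minus its multiple by the inner product of
  \<open>X\<close> and \<open>X'\<close> in the \<open>Last\<close> slot. Hence the exponential
  differentiates as in the scalar case.\<close>

lemma has_vector_derivative_transport:
  assumes X: "(X has_vector_derivative X') (at t)" and V: "(V has_vector_derivative V') (at t)"
  shows "((\<lambda>s. transport (X s) (V s)) has_vector_derivative transport (X t) (V' + rho X' (V t))) (at t)"
proof -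
  define a v b where "a = (\<lambda>s. V s $ Zero)" and "v = (\<lambda>s. \<chi> i. V s $ Mid i)" and "b = (\<lambda>s. V s $ Last)"
  define a' v' b' where "a' = V' $ Zero" and "v' = (\<chi> i. V' $ Mid i)" and "b' = V' $ Last"
  have eq: "V s = tractor (a s) (v s) (b s)" "V' = tractor a' v' b'" for s
    by (simp_all add: a_def v_def b_def a'_def v'_def b'_def tractor_eq_iff)
  have da [derivative_intros]: "(a has_real_derivative a') (at t)"
    and [derivative_intros]: "(b has_real_derivative b') (at t)"
    and v: "(v has_vector_derivative v') (at t)"
    using V by (auto simp: has_vector_derivative_vec_iff a_def v_def b_def a'_def v'_def b'_def)
  have [derivative_intros]: "((\<lambda>s. X s \<bullet> v s) has_real_derivative (X t \<bullet> v' + X' \<bullet> v t)) (at t)"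
    "((\<lambda>s. X s \<bullet> X s) has_real_derivative (X t \<bullet> X' + X' \<bullet> X t)) (at t)"
    unfolding has_real_derivative_iff_has_vector_derivative
    by (rule bounded_bilinear.has_vector_derivative[OF bounded_bilinear_inner] X v)+
  have "((\<lambda>s. a s *\<^sub>R X s) has_vector_derivative a t *\<^sub>R X' + a' *\<^sub>R X t) (at t)"
    by (rule has_vector_derivative_scaleR) (use X in \<open>auto intro: derivative_intros\<close>)
  then have mid: "((\<lambda>s. v s + a s *\<^sub>R X s) has_vector_derivative v' + (a t *\<^sub>R X' + a' *\<^sub>R X t)) (at t)"
    by (rule has_vector_derivative_add[OF v])
  have last: "((\<lambda>s. b s - X s \<bullet> v s - a s / 2 * (X s \<bullet> X s)) has_real_derivative
      b' - (X t \<bullet> v' + X' \<bullet> v t) - (a t / 2 * (X t \<bullet> X' + X' \<bullet> X t) + a' / 2 * (X t \<bullet> X t))) (at t)"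
    by (auto intro!: derivative_eq_intros simp: field_simps)
  have rhs: "tractor a' (v' + (a t *\<^sub>R X' + a' *\<^sub>R X t))
      (b' - (X t \<bullet> v' + X' \<bullet> v t) - (a t / 2 * (X t \<bullet> X' + X' \<bullet> X t) + a' / 2 * (X t \<bullet> X t)))
    = transport (X t) (V' + rho X' (V t))"
    unfolding eq
    by (simp add: algebra_simps inner_commute inner_add_left inner_add_right add_divide_distrib)
  have "(\<lambda>s. transport (X s) (V s))
    = (\<lambda>s. tractor (a s) (v s + a s *\<^sub>R X s) (b s - X s \<bullet> v s - a s / 2 * (X s \<bullet> X s)))"
    by (simp add: eq)
  with has_vector_derivative_tractor[OF da mid last, unfolded rhs] show ?thesis
    by (simp only:)
qed

text \<open>The exponential of a derivation acts on each factor of a wedge separately: the path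
  \<open>G\<close> of factorwise transported wedges solves the linear equation of the exponential
  flow, and \<open>exp_endo_eq_flow\<close> compares the values at 0 and 1.\<close>

lemma parallel_tractor4_eq:
  "parallel_tractor4 a b c d X = wedge (\<chi> p. transport (- X)
     (vector [basis_tractor a, basis_tractor b, basis_tractor c, basis_tractor d] $ p))"
proof -
  define e where "e = (vector [basis_tractor a, basis_tractor b, basis_tractor c, basis_tractor d] :: 'a tractor ^ 4)"
  define G where "G = (\<lambda>s. wedge (\<chi> p. transport (s *\<^sub>R (- X)) (e $ p)))"
  have lin: "linear (\<lambda>S. - rho_tensor X S)"
    by (rule linearI)
       (simp_all add: rho_tensor_def vec_eq_iff algebra_simps sum.distrib sum_distrib_left sum_negf)
  have "(G has_vector_derivative - rho_tensor X (G s)) (at s)" for s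
  proof -
    have D: "((\<lambda>s. transport (s *\<^sub>R (- X)) (e $ p)) has_vector_derivative
        - rho X (transport (s *\<^sub>R (- X)) (e $ p))) (at s)" for p
    proof -
      have "((\<lambda>s. s *\<^sub>R (- X)) has_vector_derivative - X) (at s)"
        by (auto intro!: derivative_eq_intros)
      \<comment> \<open>\<open>rho X\<close> commutes with transport along multiples of
        \<open>X\<close>, which brings it to the outside.\<close>
      from has_vector_derivative_transport[OF this has_vector_derivative_const[of "e $ p"]]
      show ?thesis
        by (rule has_vector_derivative_eq_rhs)
           (cases "e $ p" rule: tractor_cases, simp add: algebra_simps inner_add_right)
    qed
    define W where "W = (\<chi> q. transport (s *\<^sub>R (- X)) (e $ q))"
    have "((\<lambda>s. (\<chi> q. transport (s *\<^sub>R (- X)) (e $ q)) $ p) has_vector_derivative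
        (\<chi> q. - rho X (W $ q)) $ p) (at s)" for p
      using D[of p] by (simp add: W_def)
    from has_vector_derivative_wedge[where V' = "\<chi> q. - rho X (W $ q)", OF this]
    have "(G has_vector_derivative
        (\<Sum>p\<in>UNIV. wedge (\<chi> r. if r = p then - rho X (W $ r) else W $ r))) (at s)"
      by (simp add: G_def W_def cong: if_cong)
    \<comment> \<open>The sign is pulled out of the single replaced row; what remains is the sum in
      \<open>rho_tensor_wedge\<close>.\<close>
    moreover have "wedge (\<chi> r. if r = p then - rho X (V $ r) else V $ r)
      = - wedge (\<chi> r. if r = p then rho X (V $ r) else V $ r)" for p and V :: "'a tractor ^ 4"
    proof -
      have "det (\<chi> k. if k = p then (- 1) *s (\<chi> q. rho X (V $ k) $ (I $ q)) else (\<chi> q. V $ k $ (I $ q)))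
        = - 1 * det (\<chi> k. if k = p then (\<chi> q. rho X (V $ k) $ (I $ q)) else (\<chi> q. V $ k $ (I $ q)))" for I :: "'a tractor_index ^ 4"
        by (rule det_row_mul)
      moreover have "(\<chi> k q. (if k = p then - rho X (V $ k) else V $ k) $ (I $ q))
        = (\<chi> k. if k = p then (- 1) *s (\<chi> q. rho X (V $ k) $ (I $ q)) else (\<chi> q. V $ k $ (I $ q)))"
        "(\<chi> k q. (if k = p then rho X (V $ k) else V $ k) $ (I $ q))
        = (\<chi> k. if k = p then (\<chi> q. rho X (V $ k) $ (I $ q)) else (\<chi> q. V $ k $ (I $ q)))"
        for I :: "'a tractor_index ^ 4"
        by (simp_all add: vec_eq_iff)
      ultimately show ?thesis by (simp add: wedge_def vec_eq_iff)
    qed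
    moreover have "G s = wedge W" by (simp add: G_def W_def)
    ultimately show ?thesis
      by (simp only: rho_tensor_wedge sum_negf)
  qed
  from exp_endo_eq_flow[OF lin this]
  have "exp_endo (\<lambda>S. - rho_tensor X S) (G 0) = G 1" .
  moreover have "transport 0 v = v" for v :: "'a tractor"
    by (cases v rule: tractor_cases) simp
  ultimately show ?thesis
    by (simp add: G_def parallel_tractor4_def e_def)
qed

section \<open>Canonical tractors of a curve\<close>

lemma DERIV_inner:
  fixes Y Z :: "real \<Rightarrow> 'a::real_inner"
  assumes "(Y has_vector_derivative Y') (at t)" "(Z has_vector_derivative Z') (at t)"
  shows "((\<lambda>s. Y s \<bullet> Z s) has_real_derivative (Y t \<bullet> Z' + Y' \<bullet> Z t)) (at t)"
  unfolding has_real_derivative_iff_has_vector_derivative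
  using assms by (rule bounded_bilinear.has_vector_derivative[OF bounded_bilinear_inner])

locale regular_curve =
  fixes X :: "real \<Rightarrow> real ^ 'n::finite" and T :: "real set"
  assumes open_T: "open T"
    and smooth: "smooth_curve_on T X"
    and velocity_nz: "t \<in> T \<Longrightarrow> velocity X t \<noteq> 0"
begin

abbreviation "U \<equiv> velocity X"
abbreviation "A \<equiv> acceleration X"
abbreviation "A' \<equiv> acceleration' X"
abbreviation "A'' \<equiv> deriv_curve A'"
abbreviation "u \<equiv> speed X"

text \<open>On \<open>T\<close>, \<open>p1\<close> and \<open>p2\<close> are the successive
  derivatives of \<open>p\<close>, and \<open>w1\<close>, \<open>w2\<close>, \<open>w3\<close> those
  of \<open>w\<close>. Written out as polynomials, they serve as coefficients of the canonical
  tractors.\<close>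

definition "w t = inverse (u t)"
definition "p t = U t \<bullet> A t"
definition "p1 t = A t \<bullet> A t + U t \<bullet> A' t"
definition "p2 t = 3 * (A t \<bullet> A' t) + U t \<bullet> A'' t"
definition "w1 t = - (w t ^ 3 * p t)"
definition "w2 t = - (3 * (w t)\<^sup>2 * w1 t * p t + w t ^ 3 * p1 t)"
definition "w3 t = - (6 * w t * (w1 t)\<^sup>2 * p t + 3 * (w t)\<^sup>2 * w2 t * p t + 6 * (w t)\<^sup>2 * w1 t * p1 t
   + w t ^ 3 * p2 t)"

section \<open>Derivatives of the curve and of its scalar coefficients\<close>

lemma has_vector_derivative_curve:
  assumes "t \<in> T"
  shows "(X has_vector_derivative U t) (at t)" "(U has_vector_derivative A t) (at t)"
    "(A has_vector_derivative A' t) (at t)" "(A' has_vector_derivative A'' t) (at t)"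
    "(A'' has_vector_derivative deriv_curve A'' t) (at t)"
proof -
  have "((deriv_curve ^^ k) X has_vector_derivative deriv_curve ((deriv_curve ^^ k) X) t) (at t)" for k
    using smooth assms unfolding smooth_curve_on_def deriv_curve_def
    by (simp add: vector_derivative_works[symmetric])
  from this[of 0] this[of 1] this[of 2] this[of 3] this[of 4] show
    "(X has_vector_derivative U t) (at t)" "(U has_vector_derivative A t) (at t)"
    "(A has_vector_derivative A' t) (at t)" "(A' has_vector_derivative A'' t) (at t)"
    "(A'' has_vector_derivative deriv_curve A'' t) (at t)"
    by (simp_all add: numeral_eq_Suc)
qed

lemma speed_pos: "t \<in> T \<Longrightarrow> u t > 0"
  using velocity_nz by (simp add: speed_def)

lemma w_speed: "t \<in> T \<Longrightarrow> w t * u t = 1"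
  using speed_pos[of t] by (simp add: w_def)

lemma speed_squared: "u t * u t = U t \<bullet> U t"
  by (simp add: speed_def)

lemma DERIV_speed:
  assumes "t \<in> T"
  shows "(u has_real_derivative w t * p t) (at t)"
proof -
  have "U t \<bullet> U t > 0" using velocity_nz[OF assms] by simp
  moreover have "((\<lambda>s. U s \<bullet> U s) has_real_derivative 2 * p t) (at t)"
    using DERIV_inner[OF has_vector_derivative_curve(2)[OF assms] has_vector_derivative_curve(2)[OF assms]]
    by (simp add: p_def inner_commute)
  ultimately have "((\<lambda>s. sqrt (U s \<bullet> U s)) has_real_derivative w t * p t) (at t)"
    using DERIV_chain2[OF DERIV_real_sqrt, of "\<lambda>s. U s \<bullet> U s" t "2 * p t" UNIV]
    by (simp add: w_def speed_def)
  then show ?thesis by (simp add: speed_def[abs_def])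
qed

lemma DERIV_w:
  assumes "t \<in> T"
  shows "(w has_real_derivative w1 t) (at t)"
proof -
  have "(\<lambda>s. inverse (u s)) = w" by (simp add: w_def fun_eq_iff)
  then show ?thesis
    using DERIV_inverse'[OF DERIV_speed[OF assms]] speed_pos[OF assms]
    by (simp add: w1_def w_def power3_eq_cube mult_ac)
qed

lemma DERIV_p:
  assumes "t \<in> T"
  shows "(p has_real_derivative p1 t) (at t)"
proof -
  have "p = (\<lambda>s. U s \<bullet> A s)" by (simp add: p_def fun_eq_iff)
  then show ?thesis
    using DERIV_inner[OF has_vector_derivative_curve(2)[OF assms] has_vector_derivative_curve(3)[OF assms]]
    by (simp add: p1_def add.commute)
qed

lemma DERIV_p1:
  assumes "t \<in> T"
  shows "(p1 has_real_derivative p2 t) (at t)"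
proof -
  have "p1 = (\<lambda>s. A s \<bullet> A s + U s \<bullet> A' s)" by (simp add: p1_def fun_eq_iff)
  then show ?thesis
    using DERIV_add[OF
        DERIV_inner[OF has_vector_derivative_curve(3)[OF assms] has_vector_derivative_curve(3)[OF assms]]
        DERIV_inner[OF has_vector_derivative_curve(2)[OF assms] has_vector_derivative_curve(4)[OF assms]]]
    by (simp add: p2_def inner_commute)
qed

lemma DERIV_w1:
  assumes "t \<in> T"
  shows "(w1 has_real_derivative w2 t) (at t)"
proof -
  note [derivative_intros] = DERIV_w[OF assms] DERIV_p[OF assms]
  have "((\<lambda>s. - (w s ^ 3 * p s)) has_real_derivative w2 t) (at t)"
    unfolding w2_def by (auto intro!: derivative_eq_intros)
  moreover have "w1 = (\<lambda>s. - (w s ^ 3 * p s))" by (simp add: w1_def fun_eq_iff)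
  ultimately show ?thesis by simp
qed

lemma DERIV_w2:
  assumes "t \<in> T"
  shows "(w2 has_real_derivative w3 t) (at t)"
proof -
  note [derivative_intros] = DERIV_w[OF assms] DERIV_p[OF assms] DERIV_w1[OF assms] DERIV_p1[OF assms]
  have "((\<lambda>s. - (3 * (w s)\<^sup>2 * w1 s * p s + w s ^ 3 * p1 s)) has_real_derivative w3 t) (at t)"
    unfolding w3_def by (auto intro!: derivative_eq_intros simp: algebra_simps power2_eq_square)
  moreover have "w2 = (\<lambda>s. - (3 * (w s)\<^sup>2 * w1 s * p s + w s ^ 3 * p1 s))"
    by (simp add: w2_def fun_eq_iff)
  ultimately show ?thesis by simp
qed

text \<open>Only existence matters: it makes \<open>tractor_A'\<close> differentiable. The
  derivative of \<open>p2\<close> involves the fifth derivative of the curve.\<close>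

lemma DERIV_w3:
  assumes "t \<in> T"
  obtains D where "(w3 has_real_derivative D) (at t)"
proof -
  have "(p2 has_real_derivative 3 * (A t \<bullet> A'' t + A' t \<bullet> A' t)
      + (U t \<bullet> deriv_curve A'' t + A t \<bullet> A'' t)) (at t)"
    unfolding p2_def[abs_def]
    by (intro DERIV_add DERIV_cmult DERIV_inner has_vector_derivative_curve assms)
  then have "w field_differentiable at t" "w1 field_differentiable at t" "w2 field_differentiable at t"
    "p field_differentiable at t" "p1 field_differentiable at t" "p2 field_differentiable at t"
    using DERIV_w DERIV_w1 DERIV_w2 DERIV_p DERIV_p1 assms
    unfolding field_differentiable_def by blast+
  then have "w3 field_differentiable at t"
    unfolding w3_def[abs_def] by (intro derivative_intros)
  then show ?thesis using that by (auto simp: field_differentiable_def)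
qed

text \<open>The coordinate form of \<open>V\<close> is known on \<open>T\<close> alone, so openness
  is what transfers its derivative at \<open>t\<close>. The terms with \<open>U t\<close> come from
  \<open>rho\<close>.\<close>

lemma tractor_derivative_tractor:
  assumes t: "t \<in> T" and eq: "\<And>s. s \<in> T \<Longrightarrow> V s = tractor (a s) (v s) (b s)"
    and d: "(a has_real_derivative a') (at t)" "(v has_vector_derivative v') (at t)"
      "(b has_real_derivative b') (at t)"
  shows "(V has_vector_derivative tractor a' v' b') (at t)"
    and "tractor_derivative X V t = tractor a' (v' + a t *\<^sub>R U t) (b' - U t \<bullet> v t)"
proof -
  show V: "(V has_vector_derivative tractor a' v' b') (at t)"
    using has_vector_derivative_transform_within_open[OF has_vector_derivative_tractor[OF d] open_T t]
      eq by auto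
  show "tractor_derivative X V t = tractor a' (v' + a t *\<^sub>R U t) (b' - U t \<bullet> v t)"
    using vector_derivative_at[OF V] eq[OF t] by (simp add: tractor_derivative_def deriv_curve_def)
qed

lemma tractor_T_eq: "tractor_T X t = tractor (w t) 0 0"
  by (simp add: tractor_T_def basis_tractor_eq w_def)

lemma tractor_U_eq:
  assumes "t \<in> T"
  shows "tractor_U X t = tractor (w1 t) (w t *\<^sub>R U t) 0"
  using tractor_derivative_tractor(2)[OF assms tractor_T_eq DERIV_w[OF assms]
      has_vector_derivative_const DERIV_const]
  by (simp add: tractor_U_def)

lemma tractor_A_eq:
  assumes "t \<in> T"
  shows "tractor_A X t = tractor (w2 t) (w t *\<^sub>R A t + (2 * w1 t) *\<^sub>R U t) (- u t)"
proof -
  have "w t * (U t \<bullet> U t) = u t"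
    using w_speed[OF assms] by (simp add: speed_squared[symmetric] mult.assoc[symmetric])
  moreover have "tractor_A X t = tractor (w2 t) (w t *\<^sub>R A t + w1 t *\<^sub>R U t + w1 t *\<^sub>R U t)
      (0 - U t \<bullet> (w t *\<^sub>R U t))"
    unfolding tractor_A_def
    by (rule tractor_derivative_tractor(2)[OF assms tractor_U_eq DERIV_w1[OF assms]
        has_vector_derivative_scaleR[OF DERIV_w[OF assms] has_vector_derivative_curve(2)[OF assms]] DERIV_const])
  moreover have "w t *\<^sub>R A t + w1 t *\<^sub>R U t + w1 t *\<^sub>R U t = w t *\<^sub>R A t + (2 * w1 t) *\<^sub>R U t"
    by (simp add: vec_eq_iff)
  ultimately show ?thesis by simp
qed

text \<open>The \<open>Last\<close> slot vanishes: \<open>- (w t * p t)\<close> from differentiating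
  \<open>- u\<close>, another \<open>- (w t * p t)\<close> from the \<open>A\<close>-term and twice
  \<open>w t * p t\<close> from the \<open>U\<close>-term cancel.\<close>

lemma tractor_A'_eq:
  assumes "t \<in> T"
  shows "tractor_A' X t = tractor (w3 t) (w t *\<^sub>R A' t + (3 * w1 t) *\<^sub>R A t + (3 * w2 t) *\<^sub>R U t) 0"
proof -
  have "w1 t * (U t \<bullet> U t) = - (w t * u t) * (w t * u t) * (w t * p t)"
    by (simp add: speed_squared[symmetric] w1_def power3_eq_cube)
  then have e: "w1 t * (U t \<bullet> U t) = - (w t * p t)" by (simp add: w_speed[OF assms])
  have "tractor_A' X t = tractor (w3 t) ((w t *\<^sub>R A' t + w1 t *\<^sub>R A t)
      + ((2 * w1 t) *\<^sub>R A t + (2 * w2 t) *\<^sub>R U t) + w2 t *\<^sub>R U t)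
      (- (w t * p t) - U t \<bullet> (w t *\<^sub>R A t + (2 * w1 t) *\<^sub>R U t))"
    unfolding tractor_A'_def
    by (rule tractor_derivative_tractor(2)[OF assms tractor_A_eq])
       (auto intro!: DERIV_w2 has_vector_derivative_add has_vector_derivative_scaleR DERIV_w DERIV_cmult DERIV_w1
          has_vector_derivative_curve DERIV_minus DERIV_speed assms)
  moreover have "(w t *\<^sub>R A' t + w1 t *\<^sub>R A t) + ((2 * w1 t) *\<^sub>R A t + (2 * w2 t) *\<^sub>R U t) + w2 t *\<^sub>R U t
      = w t *\<^sub>R A' t + (3 * w1 t) *\<^sub>R A t + (3 * w2 t) *\<^sub>R U t"
    by (simp add: vec_eq_iff algebra_simps)
  moreover have "- (w t * p t) - U t \<bullet> (w t *\<^sub>R A t + (2 * w1 t) *\<^sub>R U t) = 0"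
    using e by (simp add: inner_add_right p_def)
  ultimately show ?thesis by simp
qed

text \<open>\<open>deriv_curve\<close> has the meaning of a derivative only where one exists; this
  licenses the transport rule for all four tractors.\<close>

lemma canonical_tractors_differentiable:
  assumes "t \<in> T"
  shows "tractor_T X differentiable (at t)" "tractor_U X differentiable (at t)"
    "tractor_A X differentiable (at t)" "tractor_A' X differentiable (at t)"
proof -
  note der = tractor_derivative_tractor(1)[OF assms, THEN differentiableI_vector]
  note w = DERIV_w[OF assms] DERIV_w1[OF assms] DERIV_w2[OF assms]
  note c = has_vector_derivative_curve[OF assms]
  obtain D where D: "(w3 has_real_derivative D) (at t)" using DERIV_w3[OF assms] .
  show "tractor_T X differentiable (at t)"
    by (rule der[OF tractor_T_eq w(1) has_vector_derivative_const DERIV_const])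
  show "tractor_U X differentiable (at t)"
    by (rule der[OF tractor_U_eq w(2) has_vector_derivative_scaleR[OF w(1) c(2)] DERIV_const])
  show "tractor_A X differentiable (at t)"
    by (rule der[OF tractor_A_eq w(3) has_vector_derivative_add[OF has_vector_derivative_scaleR[OF w(1) c(3)]
          has_vector_derivative_scaleR[OF DERIV_cmult[OF w(2)] c(2)]] DERIV_minus[OF DERIV_speed[OF assms]]])
  show "tractor_A' X differentiable (at t)"
    by (rule der[OF tractor_A'_eq D has_vector_derivative_add[OF has_vector_derivative_add[OF
          has_vector_derivative_scaleR[OF w(1) c(4)] has_vector_derivative_scaleR[OF DERIV_cmult[OF w(2)] c(3)]]
          has_vector_derivative_scaleR[OF DERIV_cmult[OF w(3)] c(2)]] DERIV_const])
qed

lemma has_vector_derivative_transport_curve: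
  assumes "t \<in> T" and "V differentiable (at t)"
  shows "((\<lambda>s. transport (X s) (V s)) has_vector_derivative transport (X t) (tractor_derivative X V t)) (at t)"
  unfolding tractor_derivative_def deriv_curve_def
  using has_vector_derivative_transport[OF has_vector_derivative_curve(1)[OF assms(1)]
      assms(2)[unfolded vector_derivative_works]]
  by (simp add: deriv_curve_def)

end

section \<open>Constancy of the moving wedge\<close>

lemma tractor_metric_sum_right:
  "tractor_metric v (\<Sum>q\<in>S. f q) = (\<Sum>q\<in>S. tractor_metric v (f q))"
proof -
  have 0: "tractor_metric 0 v = 0"
    by (simp add: tractor_metric_def)
  show ?thesis
    by (induction S rule: infinite_finite_induct)
       (simp_all add: 0 tractor_metric_linear tractor_metric_commute[of v])
qed

text \<open>Kernel vectors of a Gram matrix are thus the coefficients of those combinations of the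
  family that are orthogonal to the whole family.\<close>

lemma gram_mult_vector:
  "((\<chi> p q. tractor_metric (V $ p) (V $ q)) *v x) $ p = tractor_metric (V $ p) (\<Sum>q\<in>UNIV. x $ q *\<^sub>R V $ q)"
  by (simp add: matrix_vector_mult_def tractor_metric_sum_right tractor_metric_commute[of "V $ p"]
      tractor_metric_linear mult.commute)

lemma det_zero_iff_kernel:
  fixes M :: "real ^ 'k::finite ^ 'k"
  shows "det M = 0 \<longleftrightarrow> (\<exists>x. x \<noteq> 0 \<and> M *v x = 0)"
  using invertible_det_nz[of M] invertible_left_inverse[of M] matrix_left_invertible_ker[of M] by blast

lemma tensor_metric_commute: "tensor_metric S S' = tensor_metric S' S"
proof -
  have "metric_coeff a b = metric_coeff b a" for a b :: "'a tractor_index"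
    by (cases a; cases b) auto
  then have "(\<Prod>q\<in>UNIV. metric_coeff (I $ q) (J $ q)) = (\<Prod>q\<in>UNIV. metric_coeff (J $ q) (I $ q))"
    for I J :: "'a tractor_index ^ 'b" by simp
  then show ?thesis
    unfolding tensor_metric_def by (subst sum.swap) (simp add: mult_ac)
qed

lemma tensor_metric_scale: "tensor_metric (c *\<^sub>R S) S' = c * tensor_metric S S'"
  by (simp add: tensor_metric_def sum_distrib_left mult.assoc)

lemma has_real_derivative_tensor_metric:
  assumes "(S has_vector_derivative S') (at t)"
  shows "((\<lambda>s. tensor_metric (S s) (S s)) has_real_derivative 2 * tensor_metric S' (S t)) (at t)"
proof -
  have "((\<lambda>s. tensor_metric (S s) (S s)) has_real_derivative
      tensor_metric S' (S t) + tensor_metric (S t) S') (at t)"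
    using assms unfolding tensor_metric_def has_vector_derivative_vec_iff
    by (auto intro!: derivative_eq_intros simp: sum.distrib algebra_simps add_divide_distrib)
  then show ?thesis by (simp add: tensor_metric_commute[of "S t"])
qed

text \<open>Differentiating one of the first three factors repeats its successor and gives zero; in
  the last factor only the \<open>W4\<close> part of \<open>Z\<close> survives.\<close>

lemma wedge_frame_derivative:
  assumes "(W1 has_vector_derivative W2 t) (at t)" "(W2 has_vector_derivative W3 t) (at t)"
    "(W3 has_vector_derivative W4 t) (at t)" "(W4 has_vector_derivative Z) (at t)"
    and "Z = a *\<^sub>R W1 t + b *\<^sub>R W2 t + c *\<^sub>R W3 t + d *\<^sub>R W4 t"
  shows "((\<lambda>s. wedge (vector [W1 s, W2 s, W3 s, W4 s] :: 'n::finite tractor ^ 4)) has_vector_derivative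
    d *\<^sub>R wedge (vector [W1 t, W2 t, W3 t, W4 t])) (at t)"
proof -
  define V where "V s = (vector [W1 s, W2 s, W3 s, W4 s] :: 'n tractor ^ 4)" for s
  define V' where "V' = (vector [W2 t, W3 t, W4 t, Z] :: 'n tractor ^ 4)"
  have "\<forall>p. ((\<lambda>s. V s $ p) has_vector_derivative V' $ p) (at t)"
    unfolding forall_4 V_def V'_def using assms by simp
  then have "((\<lambda>s. wedge (V s)) has_vector_derivative
           (\<Sum>p\<in>UNIV. wedge (\<chi> r. if r = p then V' $ r else V t $ r))) (at t)"
    by (intro has_vector_derivative_wedge) simp
  moreover have "(\<Sum>p\<in>UNIV. wedge (\<chi> r. if r = p then V' $ r else V t $ r)) = d *\<^sub>R wedge (V t)"
    unfolding vec_eq_iff sum_4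
    by (simp add: wedge_def det_4 V_def V'_def assms(5)) (simp add: algebra_simps)
  ultimately show ?thesis by (simp add: V_def)
qed

lemma transport_vector4:
  "(vector [transport Y v1, transport Y v2, transport Y v3, transport Y v4] :: 'n::finite tractor ^ 4)
    = (\<chi> p. transport Y (vector [v1, v2, v3, v4] $ p))"
  by (simp add: vec_eq_iff forall_4)

section \<open>Dependence of the fifth canonical tractor and the transported wedge\<close>

context regular_curve
begin

text \<open>A null tractor orthogonal to the null tractor \<open>tractor_T X t\<close> is a multiple of it, because the
  tractor metric is Lorentzian; the kernel vector of the degenerate Gram matrix is applied to this.\<close>

lemma tractor_A''_dependent:
  assumes t: "t \<in> T" and "Delta4 X t \<noteq> 0" and "Delta5 X t = 0"
  obtains a b c d where "tractor_A'' X t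
    = a *\<^sub>R tractor_T X t + b *\<^sub>R tractor_U X t + c *\<^sub>R tractor_A X t + d *\<^sub>R tractor_A' X t"
proof -
  define V where "V = (vector [tractor_T X t, tractor_U X t, tractor_A X t, tractor_A' X t, tractor_A'' X t]
    :: 'n tractor ^ 5)"
  define F where "F = (vector [tractor_T X t, tractor_U X t, tractor_A X t, tractor_A' X t] :: 'n tractor ^ 4)"
  obtain x where x: "x \<noteq> 0" "(\<chi> p q. tractor_metric (V $ p) (V $ q)) *v x = 0"
    using assms(3) unfolding Delta5_def gram_det_def V_def[symmetric] det_zero_iff_kernel by blast
  define z where "z = (\<Sum>q\<in>UNIV. x $ q *\<^sub>R V $ q)"
  have orth: "tractor_metric (V $ p) z = 0" for p
    using x(2) gram_mult_vector[of V x p] by (simp add: z_def)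
  \<comment> \<open>\<open>z\<close> lies in the span to which it is orthogonal.\<close>
  have "tractor_metric z z = 0"
    by (subst (2) z_def) (simp add: tractor_metric_sum_right tractor_metric_commute[of z]
        tractor_metric_linear orth)
  moreover have "w t \<noteq> 0" using w_speed[OF t] by auto
  moreover obtain z0 zv zN where z: "z = tractor z0 zv zN" by (rule tractor_cases)
  moreover have "w t * zN = 0" using orth[of 1] by (simp add: V_def tractor_T_eq z)
  \<comment> \<open>With \<open>zN = 0\<close>, nullness says that the Euclidean norm of
    \<open>zv\<close> is zero, so only the \<open>Zero\<close> slot is left.\<close>
  ultimately have zT: "z = (z0 / w t) *\<^sub>R tractor_T X t"
    by (simp add: tractor_T_eq)
  have zsum: "z = x $ 1 *\<^sub>R tractor_T X t + x $ 2 *\<^sub>R tractor_U X t + x $ 3 *\<^sub>R tractor_A X t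
      + x $ 4 *\<^sub>R tractor_A' X t + x $ 5 *\<^sub>R tractor_A'' X t"
    by (simp add: z_def sum_5 V_def)
  \<comment> \<open>Otherwise the first four entries of \<open>x\<close> form a kernel vector of the
    Gram matrix behind \<open>Delta4\<close>, hence vanish as well.\<close>
  have "x $ 5 \<noteq> 0"
  proof
    assume 5: "x $ 5 = 0"
    define y where "y = (vector [x $ 1, x $ 2, x $ 3, x $ 4] :: real ^ 4)"
    have "(\<Sum>q\<in>UNIV. y $ q *\<^sub>R F $ q) = z"
      using zsum 5 by (simp add: sum_4 y_def F_def)
    moreover have "\<forall>p. tractor_metric (F $ p) z = 0"
      using orth[of 1] orth[of 2] orth[of 3] orth[of 4] by (simp add: forall_4 F_def V_def)
    ultimately have "((\<chi> p q. tractor_metric (F $ p) (F $ q)) *v y) $ p = 0" for p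
      by (simp add: gram_mult_vector)
    then have "(\<chi> p q. tractor_metric (F $ p) (F $ q)) *v y = 0"
      unfolding vec_eq_iff by simp
    then have "y = 0"
      using assms(2) unfolding Delta4_def gram_det_def F_def[symmetric] det_zero_iff_kernel by blast
    then have "x $ 1 = 0" "x $ 2 = 0" "x $ 3 = 0" "x $ 4 = 0"
      by (simp_all add: y_def vec_eq_iff forall_4)
    then have "x $ i = 0" for i
      using 5 exhaust_5[of i] by auto
    then have "x = 0" by (simp add: vec_eq_iff)
    with x(1) show False ..
  qed
  moreover have "x $ 5 *\<^sub>R tractor_A'' X t = (z0 / w t - x $ 1) *\<^sub>R tractor_T X t
      + (- x $ 2) *\<^sub>R tractor_U X t + (- x $ 3) *\<^sub>R tractor_A X t + (- x $ 4) *\<^sub>R tractor_A' X t"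
    using zsum zT by (simp add: algebra_simps)
  ultimately have "tractor_A'' X t = inverse (x $ 5) *\<^sub>R ((z0 / w t - x $ 1) *\<^sub>R tractor_T X t
      + (- x $ 2) *\<^sub>R tractor_U X t + (- x $ 3) *\<^sub>R tractor_A X t + (- x $ 4) *\<^sub>R tractor_A' X t)"
    using scaleR_scaleR[of "inverse (x $ 5)" "x $ 5" "tractor_A'' X t"] by simp
  then show ?thesis
    by (intro that) (simp only: scaleR_add_right scaleR_scaleR)
qed

definition moving_wedge :: "real \<Rightarrow> ('n, 4) tractor_tensor" where
  "moving_wedge s = wedge (vector [transport (X s) (tractor_T X s), transport (X s) (tractor_U X s),
     transport (X s) (tractor_A X s), transport (X s) (tractor_A' X s)])"

text \<open>By adjointness the transport moves from the basis tractors to the canonical ones, so all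
  dependence on \<open>t\<close> sits in \<open>moving_wedge\<close>.\<close>

lemma P4_eq_moving_wedge:
  "P4 X a b c d t = tensor_metric (moving_wedge t)
     (wedge (vector [basis_tractor a, basis_tractor b, basis_tractor c, basis_tractor d]))"
  by (simp add: P4_def T4_def parallel_tractor4_eq moving_wedge_def transport_vector4 tensor_metric_wedge
      tractor_metric_transport)

lemma Delta4_eq_moving_wedge: "Delta4 X t = tensor_metric (moving_wedge t) (moving_wedge t)"
  by (simp add: Delta4_def gram_det_def moving_wedge_def transport_vector4 tensor_metric_wedge)

lemma moving_wedge_constant_on:
  assumes "is_interval T" and c: "c \<noteq> 0" "\<And>t. t \<in> T \<Longrightarrow> Delta4 X t = c"
    and "\<And>t. t \<in> T \<Longrightarrow> Delta5 X t = 0"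
  shows "moving_wedge constant_on T"
proof -
  have "(moving_wedge has_vector_derivative 0) (at t)" if t: "t \<in> T" for t
  proof -
    obtain k1 k2 k3 k where k: "tractor_A'' X t
        = k1 *\<^sub>R tractor_T X t + k2 *\<^sub>R tractor_U X t + k3 *\<^sub>R tractor_A X t + k *\<^sub>R tractor_A' X t"
      using tractor_A''_dependent[OF t] c assms(4) t by metis
    note der = canonical_tractors_differentiable[OF t, THEN has_vector_derivative_transport_curve[OF t],
        folded tractor_U_def tractor_A_def tractor_A'_def tractor_A''_def]
    have "(moving_wedge has_vector_derivative k *\<^sub>R moving_wedge t) (at t)"
      unfolding moving_wedge_def[abs_def]
      by (rule wedge_frame_derivative[OF der(1-4)]) (simp add: k transport_linear)
    moreover from has_real_derivative_tensor_metric[OF this]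
    have "(Delta4 X has_real_derivative 2 * (k * c)) (at t)"
      using c(2)[OF t] by (simp add: Delta4_eq_moving_wedge[abs_def] tensor_metric_scale)
    moreover have "(Delta4 X has_real_derivative 0) (at t)"
      by (rule has_field_derivative_transform_within_open[OF DERIV_const open_T t]) (simp add: c(2))
    ultimately show ?thesis
      using DERIV_unique c(1) by fastforce
  qed
  \<comment> \<open>Here the interval enters: a zero derivative gives constancy on a convex
    set.\<close>
  then show ?thesis
    using has_vector_derivative_zero_constant[of T moving_wedge] is_interval_convex[OF assms(1)]
    unfolding constant_on_def by (metis has_vector_derivative_at_within)
qed

end

section \<open>Closed formulas\<close>

text \<open>Cofactor expansion along the row of index \<open>m\<close>. With that index isolated,
  contracting it with a vector produces inner products, as in \<open>sum_eps4_mult\<close>.\<close>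

lemma eps4_last_column:
  "eps4 i j k m Y1 Y2 Y3 Y4 = eps3 i j k Y1 Y2 Y3 * Y4 $ m - eps3 i j k Y1 Y2 Y4 * Y3 $ m
     + eps3 i j k Y1 Y3 Y4 * Y2 $ m - eps3 i j k Y2 Y3 Y4 * Y1 $ m"
  by (simp add: eps4_def eps3_def det_4 det_3 algebra_simps)

lemma eps3_last_column:
  "eps3 i j m Y1 Y2 Y3 = eps2 i j Y1 Y2 * Y3 $ m - eps2 i j Y1 Y3 * Y2 $ m + eps2 i j Y2 Y3 * Y1 $ m"
  by (simp add: eps3_def eps2_def det_3 det_2 algebra_simps)

lemma sum_eps4_mult:
  "(\<Sum>m\<in>UNIV. eps4 i j k m Y1 Y2 Y3 Y4 * x $ m) = eps3 i j k Y1 Y2 Y3 * (Y4 \<bullet> x)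
     - eps3 i j k Y1 Y2 Y4 * (Y3 \<bullet> x) + eps3 i j k Y1 Y3 Y4 * (Y2 \<bullet> x) - eps3 i j k Y2 Y3 Y4 * (Y1 \<bullet> x)"
  unfolding eps4_last_column inner_vec_def
  by (simp add: algebra_simps sum.distrib sum_subtractf sum_distrib_left)

lemma sum_eps3_mult:
  "(\<Sum>m\<in>UNIV. eps3 i j m Y1 Y2 Y3 * x $ m) = eps2 i j Y1 Y2 * (Y3 \<bullet> x)
     - eps2 i j Y1 Y3 * (Y2 \<bullet> x) + eps2 i j Y2 Y3 * (Y1 \<bullet> x)"
  unfolding eps3_last_column inner_vec_def
  by (simp add: algebra_simps sum.distrib sum_subtractf sum_distrib_left)

text \<open>By adjointness these are the slots of the transported tractor, with \<open>Zero\<close>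
  and \<open>Last\<close> exchanged because the metric pairs them with each other.\<close>

lemma tractor_metric_parallel:
  "tractor_metric (tractor a v b) (transport (- x) (basis_tractor Zero)) = b - a * (x \<bullet> x) / 2 - v \<bullet> x"
  "tractor_metric (tractor a v b) (transport (- x) (basis_tractor (Mid i))) = v $ i + a * x $ i"
  "tractor_metric (tractor a v b) (transport (- x) (basis_tractor Last)) = a"
  by (simp_all add: basis_tractor_eq inner_axis inner_axis' algebra_simps)

text \<open>Row operations with the first two rows remove \<open>w2\<close>, \<open>w3\<close> and
  the other multiples of \<open>R0\<close> and \<open>RU\<close>; of the four products left from the
  last two rows, the one with \<open>RA\<close> twice vanishes.\<close>

lemma det_canonical_frame:
  fixes R0 RU RA RB RN :: "real ^ 4"
  shows "det (vector [w *\<^sub>R R0, w1 *\<^sub>R R0 + w *\<^sub>R RU, w2 *\<^sub>R R0 + (w *\<^sub>R RA + (2 * w1) *\<^sub>R RU) - u *\<^sub>R RN,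
      w3 *\<^sub>R R0 + (w *\<^sub>R RB + (3 * w1) *\<^sub>R RA + (3 * w2) *\<^sub>R RU)] :: real ^ 4 ^ 4)
    = w ^ 4 * det (vector [R0, RU, RA, RB] :: real ^ 4 ^ 4)
      + w ^ 3 * u * det (vector [R0, RU, RB, RN] :: real ^ 4 ^ 4)
      + 3 * w\<^sup>2 * w1 * u * det (vector [R0, RU, RA, RN] :: real ^ 4 ^ 4)"
  by (simp add: det_4) algebra

context regular_curve
begin

text \<open>The four indices are packed into one function so that a list lookup supplies each of the
  index patterns of \<open>P4_formulas\<close>.\<close>

definition pairing_row :: "(nat \<Rightarrow> 'n tractor_index) \<Rightarrow> real \<Rightarrow> 'n tractor \<Rightarrow> real ^ 4" where
  "pairing_row e t v = vector [tractor_metric v (transport (- X t) (basis_tractor (e 0))),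
     tractor_metric v (transport (- X t) (basis_tractor (e 1))),
     tractor_metric v (transport (- X t) (basis_tractor (e 2))),
     tractor_metric v (transport (- X t) (basis_tractor (e 3)))]"

lemma pairing_row_linear:
  "pairing_row e t (v + v') = pairing_row e t v + pairing_row e t v'"
  "pairing_row e t (r *\<^sub>R v) = r *\<^sub>R pairing_row e t v"
  by (simp_all add: pairing_row_def vec_eq_iff forall_4 tractor_metric_linear)

lemma P4_eq:
  fixes e :: "nat \<Rightarrow> 'n tractor_index" and t :: real
  assumes t: "t \<in> T"
  defines "E \<equiv> pairing_row e t (tractor 1 0 0)" and "M \<equiv> \<lambda>v. pairing_row e t (tractor 0 v 0)"
    and "N \<equiv> pairing_row e t (tractor 0 0 1)"
  shows "P4 X (e 0) (e 1) (e 2) (e 3) t =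
    w t ^ 4 * det (vector [E, M (U t), M (A t), M (A' t)] :: real ^ 4 ^ 4)
    + (w t)\<^sup>2 * det (vector [E, M (U t), M (A' t), N] :: real ^ 4 ^ 4)
    - 3 * w t ^ 4 * p t * det (vector [E, M (U t), M (A t), N] :: real ^ 4 ^ 4)"
proof -
  have row: "pairing_row e t (tractor a (x *\<^sub>R v1 + y *\<^sub>R v2 + z *\<^sub>R v3) b)
      = a *\<^sub>R E + (x *\<^sub>R M v1 + y *\<^sub>R M v2 + z *\<^sub>R M v3) + b *\<^sub>R N" for a b x y z v1 v2 v3
    unfolding E_def M_def N_def pairing_row_linear[symmetric] by simp
  have "P4 X (e 0) (e 1) (e 2) (e 3) t = det (vector [pairing_row e t (tractor_T X t),
      pairing_row e t (tractor_U X t), pairing_row e t (tractor_A X t), pairing_row e t (tractor_A' X t)]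
      :: real ^ 4 ^ 4)"
    unfolding P4_def T4_def parallel_tractor4_eq tensor_metric_wedge pairing_row_def
    by (rule arg_cong[where f = det]) (simp add: vec_eq_iff forall_4)
  also have "\<dots> = det (vector [w t *\<^sub>R E, w1 t *\<^sub>R E + w t *\<^sub>R M (U t),
      w2 t *\<^sub>R E + (w t *\<^sub>R M (A t) + (2 * w1 t) *\<^sub>R M (U t)) - u t *\<^sub>R N,
      w3 t *\<^sub>R E + (w t *\<^sub>R M (A' t) + (3 * w1 t) *\<^sub>R M (A t) + (3 * w2 t) *\<^sub>R M (U t))] :: real ^ 4 ^ 4)"
    \<comment> \<open>Zeros pad the middle slots that have fewer than three terms.\<close>
    using row[of "w t" 0 0 0 0 0 0 0] row[of "w1 t" "w t" "U t" 0 0 0 0 0]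
      row[of "w2 t" "w t" "A t" "2 * w1 t" "U t" 0 0 "- u t"]
      row[of "w3 t" "w t" "A' t" "3 * w1 t" "A t" "3 * w2 t" "U t" 0]
    by (simp add: tractor_T_eq tractor_U_eq[OF t] tractor_A_eq[OF t] tractor_A'_eq[OF t])
  also note det_canonical_frame
  also have "w t ^ 3 * u t = (w t)\<^sup>2"
    using w_speed[OF t] by (simp add: power2_eq_square power3_eq_cube mult.assoc)
  also have "3 * (w t)\<^sup>2 * w1 t * u t = - (3 * w t ^ 4 * p t) * (w t * u t)"
    by (simp add: w1_def power2_eq_square power3_eq_cube power4_eq_xxxx)
  finally show ?thesis by (simp add: w_speed[OF t])
qed

text \<open>Without the index \<open>Zero\<close> the row \<open>N\<close> of \<open>P4_eq\<close>
  vanishes and only the first determinant remains; a \<open>Last\<close> column is then supported in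
  the row \<open>E\<close>, whose cofactor carries the minus sign absorbed in \<open>Q_ijkN\<close>.
  With \<open>Zero\<close>, the inner products with \<open>X t\<close> in its column match the
  contracted sums.\<close>

lemma P4_formulas:
  assumes t: "t \<in> T"
  shows "P4 X Zero (Mid i) (Mid j) Last t
      = 3 * w t ^ 4 * p t * eps2 i j (U t) (A t) - (w t)\<^sup>2 * eps2 i j (U t) (A' t)
        + w t ^ 4 * (\<Sum>m\<in>UNIV. eps3 i j m (U t) (A t) (A' t) * X t $ m)" (is ?zij)
    and "P4 X Zero (Mid i) (Mid j) (Mid k) t
      = 3 * w t ^ 4 * p t * eps3 i j k (X t) (U t) (A t) - (w t)\<^sup>2 * eps3 i j k (X t) (U t) (A' t)
        + 1 / 2 * (norm (X t))\<^sup>2 * w t ^ 4 * eps3 i j k (U t) (A t) (A' t)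
        + w t ^ 4 * (\<Sum>m\<in>UNIV. eps4 i j k m (X t) (U t) (A t) (A' t) * X t $ m)" (is ?zijk)
    and "P4 X (Mid i) (Mid j) (Mid k) Last t = - (w t ^ 4 * eps3 i j k (U t) (A t) (A' t))" (is ?ijk)
    and "P4 X (Mid i) (Mid j) (Mid k) (Mid l) t = w t ^ 4 * eps4 i j k l (X t) (U t) (A t) (A' t)" (is ?ijkl)
proof -
  note P4 = P4_eq[OF t, unfolded pairing_row_def tractor_metric_parallel]
  show ?zij
    using P4[of "\<lambda>q. [Zero, Mid i, Mid j, Last] ! q"] unfolding sum_eps3_mult
    by (simp add: tractor_metric_parallel det_4 eps2_def det_2 algebra_simps)
  show ?zijk
    using P4[of "\<lambda>q. [Zero, Mid i, Mid j, Mid k] ! q"] unfolding sum_eps4_mult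
    by (simp add: tractor_metric_parallel det_4 eps3_def det_3 power2_norm_eq_inner algebra_simps)
  show ?ijk
    using P4[of "\<lambda>q. [Mid i, Mid j, Mid k, Last] ! q"]
    by (simp add: tractor_metric_parallel det_4 eps3_def det_3 algebra_simps)
  show ?ijkl
    using P4[of "\<lambda>q. [Mid i, Mid j, Mid k, Mid l] ! q"]
    by (simp add: tractor_metric_parallel det_4 eps4_def algebra_simps)
qed

end

theorem proposition2p3:
  fixes X :: "real \<Rightarrow> real ^ 'n::finite" and T :: "real set"
  assumes "open T" and "is_interval T"
    and "smooth_curve_on T X"
    and "\<forall>t\<in>T. velocity X t \<noteq> 0"
    and "\<exists>c. c \<noteq> 0 \<and> (\<forall>t\<in>T. Delta4 X t = c)"
    and "\<forall>t\<in>T. Delta5 X t = 0"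
  shows "\<forall>i j k l.
      Q_0ijN X i j constant_on T \<and> Q_0ijk X i j k constant_on T \<and>
      Q_ijkN X i j k constant_on T \<and> Q_ijkl X i j k l constant_on T \<and>
      (\<forall>t\<in>T. let x = X t; U = velocity X t; A = acceleration X t; A' = acceleration' X t;
                 u = speed X t in
        Q_0ijN X i j t =
          3 * u powi (-4) * (U \<bullet> A) * eps2 i j U A - u powi (-2) * eps2 i j U A'
          + u powi (-4) * (\<Sum>m\<in>UNIV. eps3 i j m U A A' * x $ m) \<and>
        Q_0ijk X i j k t =
          3 * u powi (-4) * (U \<bullet> A) * eps3 i j k x U A - u powi (-2) * eps3 i j k x U A'
          + 1 / 2 * (norm x)\<^sup>2 * u powi (-4) * eps3 i j k U A A'
          + u powi (-4) * (\<Sum>m\<in>UNIV. eps4 i j k m x U A A' * x $ m) \<and>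
        Q_ijkN X i j k t = u powi (-4) * eps3 i j k U A A' \<and>
        Q_ijkl X i j k l t = u powi (-4) * eps4 i j k l x U A A')"
proof -
  interpret regular_curve X T
    using assms(1,3,4) by unfold_locales auto
  obtain c where "c \<noteq> 0" "\<And>t. t \<in> T \<Longrightarrow> Delta4 X t = c" using assms(5) by blast
  then have "moving_wedge constant_on T"
    using moving_wedge_constant_on assms(2,6) by blast
  then have const: "P4 X a b c d constant_on T" for a b c d
    by (auto simp: constant_on_def P4_eq_moving_wedge)
  then have "(\<lambda>t. - P4 X a b c d t) constant_on T" for a b c d
    by (force simp: constant_on_def)
  \<comment> \<open>Valid for every \<open>t\<close>, since a vanishing speed makes both sides zero
    by \<open>inverse 0 = 0\<close>.\<close>
  moreover have "speed X t powi (-4) = w t ^ 4" "speed X t powi (-2) = (w t)\<^sup>2" for t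
    by (simp_all add: power_int_minus w_def power_inverse)
  ultimately show ?thesis
    using const
    by (auto simp: Let_def Q_0ijN_def[abs_def] Q_0ijk_def[abs_def] Q_ijkN_def[abs_def] Q_ijkl_def[abs_def]
        P4_formulas p_def mult_ac)
qed

end
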